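(* Let $d,N\ge 1$ be integers, let $\vec M_1,\dots,\vec M_N\in\mathbb{Z}^d$ be pairwise distinct, and let $Q=\bigcup_{p=1}^N (Q_0+\vec M_p)$ with $Q_0=[-\tfrac12,\tfrac12)^d$. For $\vec\delta_1,\dots,\vec\delta_N\in\mathbb{R}^d$ let $\mathcal{B}(\vec\delta_1,\dots,\vec\delta_N)=\bigcup_{j=1}^N\{e^{2\pi i\langle \vec n+\vec\delta_j,\,x\rangle}\}_{\vec n\in\mathbb{Z}^d}$. Then the set $$\mathcal{L}=\{(\vec\delta_1,\dots,\vec\delta_N)\in(\mathbb{R}^d)^N:\ \mathcal{B}(\vec\delta_1,\dots,\vec\delta_N)\text{ is not a Riesz basis of }L^2(Q)\}$$ has Lebesgue measure zero (in $(\mathbb{R}^d)^N$).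
   Context: The set $\mathcal{B}(\vec\delta_1,\dots,\vec\delta_N)$ is regarded as a family indexed by $(j,\vec n)\in\{1,\dots,N\}\times\mathbb{Z}^d$ of functions of $x$ restricted to $Q$. A countable family $\{v_k\}$ in a separable Hilbert space $H$ is a frame if there are $A,B>0$ with $A\|w\|^2\le\sum_k|\langle w,v_k\rangle|^2\le B\|w\|^2$ for all $w\in H$; it is a Riesz sequence if there are $A,B>0$ with $A\sum_{k\in J}|a_k|^2\le\|\sum_{k\in J}a_kv_k\|^2\le B\sum_{k\in J}|a_k|^2$ for all finite families $\{a_k\}_{k\in J}$ of complex numbers; it is a Riesz basis if it is both. *)

theory Defs
  imports "HOL-Analysis.Analysis"
begin

text \<open>
  The elements of \<open>L\<^sup>2(M)\<close> are represented by square-integrable functions, not by their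
  almost-everywhere classes; everything below depends on functions only up to equality
  almost everywhere.  \<open>L\<^sup>2(Q)\<close> is the case \<open>M = lebesgue_on Q\<close>, where values outside
  \<open>Q\<close> are irrelevant.
\<close>

definition L2_space :: "'a measure \<Rightarrow> ('a \<Rightarrow> complex) set" where
  "L2_space M = {f \<in> borel_measurable M. integrable M (\<lambda>x. (cmod (f x))\<^sup>2)}"

definition L2_inner :: "'a measure \<Rightarrow> ('a \<Rightarrow> complex) \<Rightarrow> ('a \<Rightarrow> complex) \<Rightarrow> complex" where
  "L2_inner M f g = (\<integral>x. f x * cnj (g x) \<partial>M)"

definition L2_norm :: "'a measure \<Rightarrow> ('a \<Rightarrow> complex) \<Rightarrow> real" where
  "L2_norm M f = sqrt (\<integral>x. (cmod (f x))\<^sup>2 \<partial>M)"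

text \<open>
  Summability is required separately because \<open>infsum\<close> is 0 on families that are not
  summable.
\<close>

definition is_frame :: "'a measure \<Rightarrow> ('k \<Rightarrow> 'a \<Rightarrow> complex) \<Rightarrow> bool" where
  "is_frame M v \<longleftrightarrow>
     (\<forall>k. v k \<in> L2_space M) \<and>
     (\<exists>A>0. \<exists>B>0. \<forall>w\<in>L2_space M.
        (\<lambda>k. (cmod (L2_inner M w (v k)))\<^sup>2) summable_on UNIV \<and>
        A * (L2_norm M w)\<^sup>2 \<le> (\<Sum>\<^sub>\<infinity>k. (cmod (L2_inner M w (v k)))\<^sup>2) \<and>
        (\<Sum>\<^sub>\<infinity>k. (cmod (L2_inner M w (v k)))\<^sup>2) \<le> B * (L2_norm M w)\<^sup>2)"

definition is_Riesz_sequence :: "'a measure \<Rightarrow> ('k \<Rightarrow> 'a \<Rightarrow> complex) \<Rightarrow> bool" where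
  "is_Riesz_sequence M v \<longleftrightarrow>
     (\<forall>k. v k \<in> L2_space M) \<and>
     (\<exists>A>0. \<exists>B>0. \<forall>J. finite J \<longrightarrow> (\<forall>a :: 'k \<Rightarrow> complex.
        A * (\<Sum>k\<in>J. (cmod (a k))\<^sup>2) \<le> (L2_norm M (\<lambda>x. \<Sum>k\<in>J. a k * v k x))\<^sup>2 \<and>
        (L2_norm M (\<lambda>x. \<Sum>k\<in>J. a k * v k x))\<^sup>2 \<le> B * (\<Sum>k\<in>J. (cmod (a k))\<^sup>2)))"

definition is_Riesz_basis :: "'a measure \<Rightarrow> ('k \<Rightarrow> 'a \<Rightarrow> complex) \<Rightarrow> bool" where
  "is_Riesz_basis M v \<longleftrightarrow> is_frame M v \<and> is_Riesz_sequence M v"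

definition real_vec :: "int ^ 'd \<Rightarrow> real ^ 'd" where
  "real_vec n = (\<chi> i. real_of_int (n $ i))"

definition unit_cube :: "(real ^ 'd) set" where
  "unit_cube = {x. \<forall>i. - 1 / 2 \<le> x $ i \<and> x $ i < 1 / 2}"

definition cube_union :: "('n \<Rightarrow> int ^ 'd) \<Rightarrow> (real ^ 'd) set" where
  "cube_union M = (\<Union>p. (\<lambda>x. x + real_vec (M p)) ` unit_cube)"

definition exp_family ::
    "real ^ 'd ^ 'n \<Rightarrow> 'n \<times> (int ^ 'd) \<Rightarrow> real ^ 'd \<Rightarrow> complex" where
  "exp_family \<delta> = (\<lambda>(j, n) x.
     exp (2 * complex_of_real pi * \<i> * complex_of_real ((real_vec n + \<delta> $ j) \<bullet> x)))"

end

theory Submission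
  imports Defs "HOL-Complex_Analysis.Conformal_Mappings"
begin

text \<open>
  A function \<open>w\<close> on \<open>Q\<close> is a vector \<open>W = (w(\<cdot> + M\<^sub>p))\<^sub>p\<close> of functions on the unit cube.  Since
  \<open>\<langle>n, M\<^sub>p\<rangle>\<close> is an integer, \<open>exp (2\<pi>i \<langle>n + \<delta>\<^sub>j, x + M\<^sub>p\<rangle>)\<close> is
  \<open>exp (2\<pi>i \<langle>n, x\<rangle>) exp (2\<pi>i \<langle>\<delta>\<^sub>j, x\<rangle>) \<Gamma>\<^sub>j\<^sub>p\<close> with \<open>\<Gamma>\<^sub>j\<^sub>p = exp (2\<pi>i \<langle>\<delta>\<^sub>j, M\<^sub>p\<rangle>)\<close>.
  By Parseval on the unit cube, both sums in the definition of a Riesz basis are integrals of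
  \<open>|\<Gamma> v|\<^sup>2\<close> or \<open>|\<Gamma>\<^sup>T v|\<^sup>2\<close> for a vector field \<open>v\<close>, so the family is a Riesz basis as soon as
  \<open>\<Gamma>\<close> is invertible.

  The determinant of \<open>\<Gamma>\<close> is a trigonometric sum in \<open>\<delta>\<close> whose frequencies
  \<open>(M\<^bsub>\<sigma>(j)\<^esub>)\<^sub>j\<close> are distinct for distinct permutations \<open>\<sigma>\<close>.  On every line in a direction that
  separates these frequencies it is a nonzero analytic function of one variable, with countably many
  zeros; hence its zero set is a null set.
\<close>

section \<open>Orthonormal systems\<close>

lemma L2_norm_power2: "(L2_norm M f)\<^sup>2 = (\<integral>x. (cmod (f x))\<^sup>2 \<partial>M)"
  by (simp add: L2_norm_def)

lemma L2_space_measurable [measurable_dest]: "f \<in> L2_space M \<Longrightarrow> f \<in> borel_measurable M"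
  by (simp add: L2_space_def)

lemma L2_space_integrable: "f \<in> L2_space M \<Longrightarrow> integrable M (\<lambda>x. (cmod (f x))\<^sup>2)"
  by (simp add: L2_space_def)

lemma L2_space_dominated:
  assumes "f \<in> borel_measurable M" "integrable M g" "\<And>x. x \<in> space M \<Longrightarrow> (cmod (f x))\<^sup>2 \<le> g x"
  shows "f \<in> L2_space M"
  unfolding L2_space_def
proof (intro CollectI conjI assms(1) Bochner_Integration.integrable_bound[OF assms(2)] AE_I2)
  show "(\<lambda>x. (cmod (f x))\<^sup>2) \<in> borel_measurable M"
    using assms(1) by measurable
  show "norm ((cmod (f x))\<^sup>2) \<le> norm (g x)" if "x \<in> space M" for x
    using assms(3)[OF that] by simp
qed

lemma cmod_add_power2_le: "(cmod (a + b))\<^sup>2 \<le> 2 * (cmod a)\<^sup>2 + 2 * (cmod b)\<^sup>2"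
proof -
  have "(cmod (a + b))\<^sup>2 \<le> (cmod a + cmod b)\<^sup>2"
    by (simp add: norm_triangle_ineq power_mono)
  also have "\<dots> \<le> 2 * (cmod a)\<^sup>2 + 2 * (cmod b)\<^sup>2"
    using sum_squares_bound[of "cmod a" "cmod b"] by (simp add: power2_sum)
  finally show ?thesis .
qed

lemma L2_space_add:
  assumes "f \<in> L2_space M" "g \<in> L2_space M"
  shows "(\<lambda>x. f x + g x) \<in> L2_space M"
proof (rule L2_space_dominated)
  show "integrable M (\<lambda>x. 2 * (cmod (f x))\<^sup>2 + 2 * (cmod (g x))\<^sup>2)"
    using assms by (auto simp: L2_space_def)
qed (use assms in \<open>auto intro: cmod_add_power2_le L2_space_measurable\<close>)

lemma L2_space_mult: "f \<in> L2_space M \<Longrightarrow> (\<lambda>x. c * f x) \<in> L2_space M"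
  by (auto simp: L2_space_def norm_mult power_mult_distrib)

lemma L2_space_diff:
  assumes "f \<in> L2_space M" "g \<in> L2_space M"
  shows "(\<lambda>x. f x - g x) \<in> L2_space M"
  using L2_space_add[OF assms(1) L2_space_mult[OF assms(2), of "-1"]] by simp

lemma L2_space_zero: "(\<lambda>x. 0) \<in> L2_space M"
  by (simp add: L2_space_def)

lemma L2_space_sum:
  assumes "\<And>k. k \<in> J \<Longrightarrow> f k \<in> L2_space M"
  shows "(\<lambda>x. \<Sum>k\<in>J. f k x) \<in> L2_space M"
  using assms
  by (induction J rule: infinite_finite_induct) (auto intro: L2_space_zero L2_space_add)

lemma integrable_L2_inner:
  assumes "f \<in> L2_space M" "g \<in> L2_space M"
  shows "integrable M (\<lambda>x. f x * cnj (g x))"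
proof (rule Bochner_Integration.integrable_bound)
  show "integrable M (\<lambda>x. (cmod (f x))\<^sup>2 + (cmod (g x))\<^sup>2)"
    using assms by (auto simp: L2_space_def)
  show "(\<lambda>x. f x * cnj (g x)) \<in> borel_measurable M"
    using assms
    by (intro borel_measurable_times measurable_compose[OF _ borel_measurable_continuous_onI[of cnj]])
      (auto intro: L2_space_measurable continuous_intros)
  have "cmod (f x) * cmod (g x) \<le> (cmod (f x))\<^sup>2 + (cmod (g x))\<^sup>2" for x
    using sum_squares_bound[of "cmod (f x)" "cmod (g x)"]
      mult_nonneg_nonneg[OF norm_ge_zero norm_ge_zero, of "f x" "g x"] by linarith
  then show "AE x in M. norm (f x * cnj (g x)) \<le> norm ((cmod (f x))\<^sup>2 + (cmod (g x))\<^sup>2)"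
    by (simp add: norm_mult)
qed

lemma L2_inner_diff_left:
  assumes "f \<in> L2_space M" "g \<in> L2_space M" "h \<in> L2_space M"
  shows "L2_inner M (\<lambda>x. f x - c * g x) h = L2_inner M f h - c * L2_inner M g h"
proof -
  have "L2_inner M (\<lambda>x. f x - c * g x) h
      = (\<integral>x. f x * cnj (h x) - c * (g x * cnj (h x)) \<partial>M)"
    unfolding L2_inner_def by (simp add: algebra_simps)
  also have "\<dots> = L2_inner M f h - c * L2_inner M g h"
    unfolding L2_inner_def
    using integrable_L2_inner[OF assms(1,3)] integrable_L2_inner[OF assms(2,3)]
    by (subst Bochner_Integration.integral_diff) auto
  finally show ?thesis .
qed

lemma L2_inner_self: "L2_inner M f f = complex_of_real (\<integral>x. (cmod (f x))\<^sup>2 \<partial>M)"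
proof -
  have "L2_inner M f f = (\<integral>x. complex_of_real ((cmod (f x))\<^sup>2) \<partial>M)"
    unfolding L2_inner_def by (intro Bochner_Integration.integral_cong) (simp_all only: complex_norm_square)
  then show ?thesis
    by (simp only: integral_complex_of_real)
qed

lemma cmod_diff_mult_power2:
  "(cmod (a - c * b))\<^sup>2 = (cmod a)\<^sup>2 - 2 * Re (cnj c * (a * cnj b)) + (cmod c)\<^sup>2 * (cmod b)\<^sup>2"
  unfolding cmod_power2 by (simp add: algebra_simps power2_eq_square)

lemma L2_diff_mult_power2:
  assumes "f \<in> L2_space M" "g \<in> L2_space M"
  shows "(\<integral>x. (cmod (f x - c * g x))\<^sup>2 \<partial>M)
    = (\<integral>x. (cmod (f x))\<^sup>2 \<partial>M) - 2 * Re (cnj c * L2_inner M f g)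
      + (cmod c)\<^sup>2 * (\<integral>x. (cmod (g x))\<^sup>2 \<partial>M)"
proof -
  note [simp] = L2_space_integrable[OF assms(1)] L2_space_integrable[OF assms(2)]
  have i: "integrable M (\<lambda>x. cnj c * (f x * cnj (g x)))"
    using integrable_L2_inner[OF assms] by simp
  have "(\<integral>x. Re (cnj c * (f x * cnj (g x))) \<partial>M) = Re (\<integral>x. cnj c * (f x * cnj (g x)) \<partial>M)"
    using i by (rule integral_Re)
  also have "\<dots> = Re (cnj c * L2_inner M f g)"
    unfolding L2_inner_def by simp
  finally have *: "(\<integral>x. Re (cnj c * (f x * cnj (g x))) \<partial>M) = Re (cnj c * L2_inner M f g)" .
  show ?thesis
    unfolding cmod_diff_mult_power2 *[symmetric]
    using integrable_Re[OF i]
    by (simp del: minus_complex.simps times_complex.simps complex_cnj_mult cnj.simps)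
qed

section \<open>Bessel's inequality and Parseval's identity\<close>

locale orthonormal_system =
  fixes M :: "'a measure" and v :: "'k \<Rightarrow> 'a \<Rightarrow> complex"
  assumes L2: "v k \<in> L2_space M"
    and orthonormal: "L2_inner M (v k) (v l) = of_bool (k = l)"
begin

lemma diff_sum_L2: "f \<in> L2_space M \<Longrightarrow> (\<lambda>x. f x - (\<Sum>k\<in>J. a k * v k x)) \<in> L2_space M"
  by (intro L2_space_diff L2_space_sum L2_space_mult L2)

text \<open>This is the identity behind best approximation, proved by subtracting one vector at a
  time. For \<open>a\<close> equal to the Fourier coefficients the last sum vanishes, which yields
  Bessel's inequality; for \<open>f\<close> equal to zero it is Pythagoras.\<close>

lemma norm_diff_sum_power2:
  assumes "finite J" and f: "f \<in> L2_space M"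
  shows "(\<integral>x. (cmod (f x - (\<Sum>k\<in>J. a k * v k x)))\<^sup>2 \<partial>M)
    = (\<integral>x. (cmod (f x))\<^sup>2 \<partial>M) - (\<Sum>k\<in>J. (cmod (L2_inner M f (v k)))\<^sup>2)
      + (\<Sum>k\<in>J. (cmod (a k - L2_inner M f (v k)))\<^sup>2)"
proof -
  \<comment> \<open>The induction carries a second claim: subtracting multiples of the vectors in
    \<open>J\<close> leaves the coefficients outside \<open>J\<close> unchanged. So the remainder
    has the same coefficient as \<open>f\<close> at the next index.\<close>
  have "(\<forall>l. l \<notin> J \<longrightarrow> L2_inner M (\<lambda>x. f x - (\<Sum>k\<in>J. a k * v k x)) (v l) = L2_inner M f (v l)) \<and> ?thesis"
    using assms(1)
  proof (induction J)
    case (insert j J)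
    let ?r = "\<lambda>x. f x - (\<Sum>k\<in>J. a k * v k x)"
    have r: "?r \<in> L2_space M"
      by (rule diff_sum_L2[OF f])
    have eq: "f x - (\<Sum>k\<in>insert j J. a k * v k x) = ?r x - a j * v j x" for x
      using insert.hyps by (simp add: algebra_simps)
    have one: "(\<integral>x. (cmod (v j x))\<^sup>2 \<partial>M) = 1"
      using orthonormal[of j j] unfolding L2_inner_self by (simp add: of_real_eq_1_iff)
    have rj: "L2_inner M ?r (v j) = L2_inner M f (v j)"
      using insert.IH[THEN conjunct1] insert.hyps(2) by simp
    show ?case
      unfolding eq
    proof (intro conjI allI impI)
      fix l assume "l \<notin> insert j J"
      then show "L2_inner M (\<lambda>x. ?r x - a j * v j x) (v l) = L2_inner M f (v l)"
        using insert.IH[THEN conjunct1] by (simp add: L2_inner_diff_left[OF r L2 L2] orthonormal)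
        (use \<open>l \<notin> insert j J\<close> in auto)
    next
      \<comment> \<open>Completing the square turns the two terms in \<open>a j\<close> into the
        squared distance of \<open>a j\<close> from the coefficient of \<open>f\<close>, minus the
        square of that coefficient.\<close>
      have "(cmod (a j - b))\<^sup>2 = (cmod b)\<^sup>2 - 2 * Re (cnj (a j) * b) + (cmod (a j))\<^sup>2" for b
        unfolding cmod_power2 by (simp add: algebra_simps power2_eq_square)
      then show "(\<integral>x. (cmod (?r x - a j * v j x))\<^sup>2 \<partial>M)
        = (\<integral>x. (cmod (f x))\<^sup>2 \<partial>M) - (\<Sum>k\<in>insert j J. (cmod (L2_inner M f (v k)))\<^sup>2)
          + (\<Sum>k\<in>insert j J. (cmod (a k - L2_inner M f (v k)))\<^sup>2)"
        using insert.IH[THEN conjunct2] insert.hyps by (simp add: L2_diff_mult_power2[OF r L2] one rj)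
    qed
  qed auto
  then show ?thesis
    by (rule conjunct2)
qed

lemma norm_sum_power2:
  assumes "finite J"
  shows "(\<integral>x. (cmod (\<Sum>k\<in>J. a k * v k x))\<^sup>2 \<partial>M) = (\<Sum>k\<in>J. (cmod (a k))\<^sup>2)"
  using norm_diff_sum_power2[OF assms L2_space_zero, of a] by (simp add: L2_inner_def)

text \<open>The partial sums increase with the finite index set and never exceed the squared norm.
  One good approximation over \<open>J\<close> makes the deficit small at \<open>J\<close>, since
  the Fourier coefficients do at least as well as \<open>a\<close>, and hence small at every finite
  superset.\<close>

lemma Parseval:
  assumes f: "f \<in> L2_space M"
    and dense: "\<And>\<epsilon>. \<epsilon> > 0 \<Longrightarrow> \<exists>J a. finite J \<and> (\<integral>x. (cmod (f x - (\<Sum>k\<in>J. a k * v k x)))\<^sup>2 \<partial>M) < \<epsilon>"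
  shows "((\<lambda>k. (cmod (L2_inner M f (v k)))\<^sup>2) has_sum (\<integral>x. (cmod (f x))\<^sup>2 \<partial>M)) UNIV"
  unfolding has_sum_def tendsto_iff eventually_finite_subsets_at_top
proof (intro allI impI)
  fix \<epsilon> :: real assume "\<epsilon> > 0"
  from dense[OF this] obtain J a where J: "finite J"
    and lt: "(\<integral>x. (cmod (f x - (\<Sum>k\<in>J. a k * v k x)))\<^sup>2 \<partial>M) < \<epsilon>"
    by (elim exE conjE)
  let ?c = "\<lambda>k. (cmod (L2_inner M f (v k)))\<^sup>2"
  have "dist (sum ?c K) (\<integral>x. (cmod (f x))\<^sup>2 \<partial>M) < \<epsilon>" if "finite K" "J \<subseteq> K" for K
  proof -
    \<comment> \<open>With the Fourier coefficients as coefficients, nonnegativity of the remainder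
      is Bessel's inequality.\<close>
    have "0 \<le> (\<integral>x. (cmod (f x - (\<Sum>k\<in>K. L2_inner M f (v k) * v k x)))\<^sup>2 \<partial>M)"
      by simp
    then have "(\<integral>x. (cmod (f x))\<^sup>2 \<partial>M) - sum ?c K \<ge> 0"
      unfolding norm_diff_sum_power2[OF \<open>finite K\<close> f] by simp
    moreover have "(\<integral>x. (cmod (f x))\<^sup>2 \<partial>M) - sum ?c J < \<epsilon>"
      using lt norm_diff_sum_power2[OF J f, of a] sum_nonneg[of J "\<lambda>k. (cmod (a k - L2_inner M f (v k)))\<^sup>2"]
      by simp
    moreover have "sum ?c J \<le> sum ?c K"
      by (rule sum_mono2) (use that in auto)
    ultimately show ?thesis
      by (simp add: dist_real_def)
  qed
  then show "\<exists>X. finite X \<and> X \<subseteq> UNIV \<and> (\<forall>Y. finite Y \<and> X \<subseteq> Y \<and> Y \<subseteq> UNIV \<longrightarrow>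
      dist (sum ?c Y) (\<integral>x. (cmod (f x))\<^sup>2 \<partial>M) < \<epsilon>)"
    using J by (intro exI[of _ J] conjI allI impI) simp_all
qed

end

section \<open>Zero sets of trigonometric sums\<close>

text \<open>As \<open>t\<close> tends to infinity the term with the largest exponent dominates, so
  its coefficient must vanish; the argument then repeats on the remaining terms.\<close>

lemma exp_sum_zero_imp_coeff_zero:
  fixes a :: "'k \<Rightarrow> real" and c :: "'k \<Rightarrow> complex"
  assumes "finite S" "inj_on a S"
    and zero: "\<And>t::real. (\<Sum>k\<in>S. c k * exp (of_real (a k * t))) = 0"
  shows "\<forall>k\<in>S. c k = 0"
  using assms
proof (induction S rule: finite_psubset_induct)
  case (psubset S)
  show ?case
  proof (cases "S = {}")
    case False
    then have "Max (a ` S) \<in> a ` S"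
      using psubset.hyps(1) by (intro Max_in) auto
    then obtain m where "m \<in> S" "a m = Max (a ` S)"
      by auto
    then have m: "m \<in> S" "\<And>k. k \<in> S \<Longrightarrow> a k \<le> a m"
      using psubset.hyps(1) by auto
    have lt: "a k < a m" if "k \<in> S - {m}" for k
      using that m(2)[of k] inj_onD[OF psubset.prems(1), of k m] m(1) by force
    \<comment> \<open>Dividing by the dominant exponential sends every term but that of
      \<open>m\<close> to 0.\<close>
    have "((\<lambda>t. \<Sum>k\<in>S. c k * of_real (exp ((a k - a m) * t))) \<longlongrightarrow>
        (\<Sum>k\<in>S. c k * (if k = m then 1 else 0))) at_top"
    proof (intro tendsto_sum tendsto_mult tendsto_const)
      fix k assume k: "k \<in> S"
      have "((\<lambda>t. exp ((a k - a m) * t)) \<longlongrightarrow> 0) at_top" if "k \<noteq> m"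
      proof (rule filterlim_compose[OF exp_at_bot])
        show "filterlim (\<lambda>t. (a k - a m) * t) at_bot at_top"
          using lt[of k] k that
          by (intro filterlim_tendsto_neg_mult_at_bot[OF tendsto_const]) (auto intro: filterlim_ident)
      qed
      then show "((\<lambda>t. complex_of_real (exp ((a k - a m) * t))) \<longlongrightarrow> (if k = m then 1 else 0)) at_top"
        using tendsto_of_real[of "\<lambda>t. exp ((a k - a m) * t)" 0 at_top, where 'a=complex] by auto
    qed
    moreover have "(\<Sum>k\<in>S. c k * of_real (exp ((a k - a m) * t))) = 0" for t
    proof -
      have "(\<Sum>k\<in>S. c k * of_real (exp ((a k - a m) * t)))
          = (\<Sum>k\<in>S. c k * exp (of_real (a k * t))) * exp (of_real (- a m * t))"
        unfolding sum_distrib_right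
      proof (rule sum.cong)
        fix k
        have "exp ((a k - a m) * t) = exp (a k * t) * exp (- a m * t)"
          by (simp add: algebra_simps flip: exp_add)
        then show "c k * of_real (exp ((a k - a m) * t))
            = c k * exp (of_real (a k * t)) * exp (of_real (- a m * t))"
          unfolding exp_of_real by simp
      qed simp
      then show ?thesis
        using psubset.prems(2) by simp
    qed
    ultimately have "(\<Sum>k\<in>S. c k * (if k = m then 1 else 0)) = 0"
      by (simp add: tendsto_const_iff)
    then have cm: "c m = 0"
      using m(1) psubset.hyps(1) by (simp add: sum.remove)
    have "\<forall>k\<in>S - {m}. c k = 0"
    proof (rule psubset.IH)
      show "S - {m} \<subset> S" "inj_on a (S - {m})"
        using m(1) psubset.prems(1) by (auto intro: inj_on_subset)
      show "(\<Sum>k\<in>S - {m}. c k * exp (of_real (a k * t))) = 0" for t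
        using psubset.prems(2)[of t] psubset.hyps(1) m(1) cm by (simp add: sum.remove)
    qed
    with cm show ?thesis
      by blast
  qed auto
qed

text \<open>The sum extends to an entire function \<open>F\<close>. A nonconstant entire function
  has countably many zeros, and the real zeros are among them.\<close>

lemma countable_zeros_exp_sum:
  fixes a :: "'k \<Rightarrow> real" and c :: "'k \<Rightarrow> complex"
  assumes "finite S" "inj_on a S" "k \<in> S" "c k \<noteq> 0"
  shows "countable {t::real. (\<Sum>k\<in>S. c k * exp (\<i> * of_real (a k * t))) = 0}"
proof -
  define F where "F z = (\<Sum>k\<in>S. c k * exp (\<i> * of_real (a k) * z))" for z
  \<comment> \<open>A constant \<open>F\<close> with a zero would vanish identically, in particular
    on the imaginary axis, where it is a sum of real exponentials with distinct exponents.\<close>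
  have "\<not> F constant_on UNIV \<or> (\<forall>z. F z \<noteq> 0)"
  proof (rule ccontr)
    assume "\<not> ?thesis"
    then have F0: "F z = 0" for z
      unfolding constant_on_def by (metis UNIV_I)
    have "(\<Sum>k\<in>S. c k * exp (of_real (a k * t))) = 0" for t
      using F0[of "- \<i> * of_real t"] unfolding F_def by (simp add: mult.assoc) (simp add: algebra_simps)
    then show False
      using exp_sum_zero_imp_coeff_zero[OF assms(1,2)] assms(3,4) by blast
  qed
  then have "countable {z \<in> UNIV. F z = 0}"
  proof
    assume "\<not> F constant_on UNIV"
    then show ?thesis
      by (intro holomorphic_countable_zeros)
        (auto simp: F_def[abs_def] intro!: holomorphic_intros fsigma_UNIV)
  qed auto
  then have "countable (UNIV \<inter> (\<lambda>t. complex_of_real t) -` {z \<in> UNIV. F z = 0})"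
    by (intro countable_image_inj_Int_vimage) (auto simp: inj_on_def)
  then show ?thesis
    by (rule countable_subset[rotated]) (auto simp: F_def mult.assoc)
qed

text \<open>The bad vectors are orthogonal to a difference of two distinct points of
  \<open>S\<close>. They fill only finitely many hyperplanes, hence not the whole space.\<close>

lemma exists_separating_vector:
  fixes S :: "'a::euclidean_space set"
  assumes "finite S"
  obtains u where "inj_on (\<lambda>x. x \<bullet> u) S"
proof -
  have "negligible (\<Union>(x, y) \<in> S \<times> S - Id. {u. (x - y) \<bullet> u = 0})"
    using assms by (intro negligible_Union finite_imageI) (auto intro: negligible_hyperplane)
  then have "(\<Union>(x, y) \<in> S \<times> S - Id. {u. (x - y) \<bullet> u = 0}) \<noteq> UNIV"
    using non_negligible_UNIV by metis
  then obtain u where "\<forall>x\<in>S. \<forall>y\<in>S. x \<noteq> y \<longrightarrow> (x - y) \<bullet> u \<noteq> 0"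
    by auto
  then show thesis
    by (intro that[of u] inj_onI) (auto simp: inner_diff_left)
qed

text \<open>
  Tonelli for \<open>{(x, t). x + tu \<in> Z, 0 \<le> t \<le> 1}\<close>: each slice in \<open>x\<close> is a translate of \<open>Z\<close>,
  so no rotation of \<open>u\<close> to a coordinate axis is needed.
\<close>

lemma null_set_if_countable_on_lines:
  fixes Z :: "'a::euclidean_space set"
  assumes [measurable]: "Z \<in> sets borel" and "\<And>x. countable {t::real. x + t *\<^sub>R u \<in> Z}"
  shows "Z \<in> null_sets lborel"
proof -
  let ?h = "\<lambda>x t. indicator Z (x + t *\<^sub>R u) * indicator {0..1} (t::real) :: ennreal"
  have vertical: "(\<integral>\<^sup>+t. ?h x t \<partial>lborel) = 0" for x
  proof -
    have "AE t in lborel. t \<notin> {t. x + t *\<^sub>R u \<in> Z}"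
      by (rule AE_not_in) (rule countable_imp_null_set_lborel[OF assms(2)])
    then have "AE t in lborel. ?h x t = 0"
      by eventually_elim auto
    then show ?thesis
      by (simp add: nn_integral_0_iff_AE)
  qed
  have horizontal: "(\<integral>\<^sup>+x. ?h x t \<partial>lborel) = emeasure lborel Z * indicator {0..1} t" for t
  proof -
    have "(\<integral>\<^sup>+x. indicator Z (x + t *\<^sub>R u) \<partial>lborel)
        = (\<integral>\<^sup>+x. indicator Z x \<partial>distr lborel borel ((+) (t *\<^sub>R u)))"
      by (subst nn_integral_distr) (auto simp: add.commute)
    also have "\<dots> = emeasure lborel Z"
      by (simp add: lborel_distr_plus)
    finally show ?thesis
      by (simp add: nn_integral_multc)
  qed
  have "(\<integral>\<^sup>+t. \<integral>\<^sup>+x. ?h x t \<partial>lborel \<partial>lborel) = (\<integral>\<^sup>+x. \<integral>\<^sup>+t. ?h x t \<partial>lborel \<partial>lborel)"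
    by (rule lborel_pair.Fubini') measurable
  then have "emeasure lborel Z * emeasure lborel {0..1::real} = 0"
    unfolding vertical horizontal by (simp add: nn_integral_cmult)
  then show ?thesis
    by (auto simp: null_sets_def)
qed

text \<open>A direction \<open>u\<close> that keeps the frequencies distinct after projection
  reduces the claim to sums of exponentials in one real variable, one for each line parallel to
  \<open>u\<close>.\<close>

lemma null_set_zeros_trig_sum:
  fixes w :: "'k \<Rightarrow> 'a::euclidean_space" and c :: "'k \<Rightarrow> complex"
  assumes "finite S" "inj_on w S" "k \<in> S" "c k \<noteq> 0"
  shows "{x. (\<Sum>k\<in>S. c k * exp (\<i> * of_real (w k \<bullet> x))) = 0} \<in> null_sets lborel"
    (is "?Z \<in> _")
proof -
  obtain u where "inj_on (\<lambda>x. x \<bullet> u) (w ` S)"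
    using finite_imageI[OF assms(1)] by (rule exists_separating_vector)
  then have inj: "inj_on (\<lambda>k. w k \<bullet> u) S"
    using assms(2) comp_inj_on[of w S "\<lambda>x. x \<bullet> u"] by (simp add: comp_def)
  show ?thesis
  proof (rule null_set_if_countable_on_lines)
    have "closed ?Z"
      by (intro closed_Collect_eq continuous_intros)
    then show "?Z \<in> sets borel"
      by simp
    show "countable {t. x + t *\<^sub>R u \<in> ?Z}" for x
    proof -
      \<comment> \<open>The base point \<open>x\<close> of the line contributes a nonzero factor to
        each coefficient, so the coefficient of \<open>k\<close> stays nonzero.\<close>
      have "countable {t::real. (\<Sum>k\<in>S. (c k * exp (\<i> * of_real (w k \<bullet> x))) *
          exp (\<i> * of_real ((w k \<bullet> u) * t))) = 0}"
        by (rule countable_zeros_exp_sum[OF assms(1) inj assms(3)]) (simp add: assms(4))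
      moreover have "(c k * exp (\<i> * of_real (w k \<bullet> x))) * exp (\<i> * of_real ((w k \<bullet> u) * t))
          = c k * exp (\<i> * of_real (w k \<bullet> (x + t *\<^sub>R u)))" for k t
        unfolding mult.assoc exp_add[symmetric] by (simp add: inner_add_right distrib_left mult.commute)
      ultimately show ?thesis
        by (simp only: mem_Collect_eq)
    qed
  qed
qed

section \<open>Exponentials on the unit cube\<close>

lemma L2_space_bounded:
  assumes "finite_measure M" "f \<in> borel_measurable M" "\<And>x. x \<in> space M \<Longrightarrow> cmod (f x) \<le> B"
  shows "f \<in> L2_space M"
proof (rule L2_space_dominated[OF assms(2)])
  show "integrable M (\<lambda>x. B\<^sup>2)"
    using assms(1) by (rule finite_measure.integrable_const)
qed (use assms(3) in \<open>auto intro: power_mono\<close>)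

text \<open>Comparing the half-open cube with the closed box gives measurability and boundedness,
  and later separates off the boundary.\<close>

lemma unit_cube_eq: "unit_cube = cbox (\<chi> i. - 1 / 2) (\<chi> i. 1 / 2) - (\<Union>i. {x :: real^'d. x $ i = 1 / 2})"
  by (auto simp: unit_cube_def mem_box_cart less_le)

lemma borel_unit_cube [measurable]: "unit_cube \<in> sets (borel :: (real^'d) measure)"
  unfolding unit_cube_eq by (intro sets.Diff sets.finite_UN) (auto intro!: borel_closed closed_Collect_eq continuous_intros)

lemma lmeasurable_unit_cube: "(unit_cube :: (real^'d) set) \<in> lmeasurable"
proof (rule bounded_set_imp_lmeasurable)
  show "bounded (unit_cube :: (real^'d) set)"
    by (rule bounded_subset[OF bounded_cbox]) (auto simp: unit_cube_eq)
qed simp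

text \<open>The product form lets integrals over the cube split into one-dimensional ones.\<close>

lemma indicator_unit_cube:
  "indicator unit_cube x = (\<Prod>b\<in>Basis. indicator {- 1 / 2..<1 / 2} (x \<bullet> b) :: real)"
proof (cases "x \<in> unit_cube")
  case True
  then have "x \<bullet> b \<in> {- 1 / 2..<1 / 2}" if "b \<in> Basis" for b
    using that by (auto simp: unit_cube_def Basis_vec_def inner_axis)
  with True show ?thesis
    by simp
next
  case False
  then obtain i where "x \<bullet> axis i 1 \<notin> {- 1 / 2..<1 / 2}"
    by (auto simp: unit_cube_def inner_axis)
  moreover have "axis i 1 \<in> (Basis :: (real^'a) set)"
    by (auto simp: Basis_vec_def)
  ultimately have "(\<Prod>b\<in>Basis. indicator {- 1 / 2..<1 / 2} (x \<bullet> b) :: real) = 0"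
    by (intro prod_zero bexI[of _ "axis i 1"]) simp_all
  with False show ?thesis
    by simp
qed

section \<open>Orthonormality of the integer exponentials\<close>

definition cube_exp :: "int ^ 'd \<Rightarrow> real ^ 'd \<Rightarrow> complex" where
  "cube_exp n x = exp (2 * complex_of_real pi * \<i> * complex_of_real (real_vec n \<bullet> x))"

lemma norm_cube_exp [simp]: "cmod (cube_exp n x) = 1"
  by (simp add: cube_exp_def)

lemma continuous_on_cube_exp [continuous_intros]: "continuous_on S (cube_exp n)"
  unfolding cube_exp_def[abs_def] by (intro continuous_intros)

lemma real_vec_add: "real_vec (m + n) = real_vec m + real_vec n"
  by (simp add: real_vec_def vec_eq_iff)

lemma real_vec_minus: "real_vec (- n) = - real_vec n"
  by (simp add: real_vec_def vec_eq_iff)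

lemma real_vec_eq_iff: "real_vec m = real_vec n \<longleftrightarrow> m = n"
  by (simp add: real_vec_def vec_eq_iff)

lemma cube_exp_mult: "cube_exp m x * cube_exp n x = cube_exp (m + n) x"
  by (simp add: cube_exp_def real_vec_add inner_add_left distrib_left exp_add)

lemma cnj_cube_exp: "cnj (cube_exp n x) = cube_exp (- n) x"
  by (simp add: cube_exp_def exp_cnj real_vec_minus)

text \<open>For nonzero \<open>k\<close> the integrand has a periodic primitive, and the endpoints
  are one period apart.\<close>

lemma integral_exp_unit_interval:
  fixes k :: int
  shows "(\<integral>t. indicator {- 1 / 2..<1 / 2} t *\<^sub>R exp (2 * complex_of_real pi * \<i> * of_real (k * t)) \<partial>lborel)
    = of_bool (k = 0)" (is "?I = _")
proof -
  let ?f = "\<lambda>t::real. exp (2 * complex_of_real pi * \<i> * of_real (k * t))"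
  \<comment> \<open>The fundamental theorem is applied on the closed interval; the added endpoint is
    a null set.\<close>
  have "?I = (\<integral>t. indicator {- 1 / 2..1 / 2} t *\<^sub>R ?f t \<partial>lborel)"
  proof (rule integral_cong_AE)
    show "AE t in lborel. indicator {- 1 / 2..<1 / 2} t *\<^sub>R ?f t = indicator {- 1 / 2..1 / 2} t *\<^sub>R ?f t"
      using AE_lborel_singleton[of "1/2"] by eventually_elim (auto simp: indicator_def)
  qed (auto intro!: borel_measurable_continuous_onI borel_measurable_scaleR continuous_intros)
  also have "\<dots> = of_bool (k = 0)"
  proof (cases "k = 0")
    case False
    let ?F = "\<lambda>t::real. ?f t / (2 * complex_of_real pi * \<i> * of_int k)"
    have "has_bochner_integral lborel (\<lambda>t. indicator {- 1 / 2..1 / 2} t *\<^sub>R ?f t) (?F (1 / 2) - ?F (- 1 / 2))"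
    proof (rule has_bochner_integral_FTC_Icc)
      fix t :: real
      have "((\<lambda>z. exp (2 * complex_of_real pi * \<i> * of_int k * z) / (2 * complex_of_real pi * \<i> * of_int k))
          has_field_derivative exp (2 * complex_of_real pi * \<i> * of_int k * of_real t)) (at (of_real t))"
        using False by (auto intro!: derivative_eq_intros)
      from has_vector_derivative_real_field[OF this]
      show "(?F has_vector_derivative ?f t) (at t within {- 1 / 2..1 / 2})"
        by (simp add: mult.assoc)
    qed (auto intro!: continuous_intros)
    moreover have "?f (1 / 2) = ?f (- 1 / 2)"
    proof -
      have "?f (1 / 2) = ?f (- 1 / 2) * exp (of_int (2 * k) * of_real pi * \<i>)"
        unfolding exp_add[symmetric] by (intro arg_cong[where f=exp]) (simp add: field_simps)
      then show ?thesis
        by (simp add: exp_integer_2pi mult.commute mult.left_commute)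
    qed
    ultimately show ?thesis
      using False by (simp add: has_bochner_integral_iff)
  qed (simp add: scaleR_conv_of_real)
  finally show ?thesis .
qed

text \<open>Indicator and exponential both factor over the coordinates, so the integral is a product
  of one-dimensional integrals, and a single nonzero entry of \<open>n\<close> makes it 0.\<close>

lemma integral_cube_exp:
  "(\<integral>x. cube_exp n x \<partial>lebesgue_on unit_cube) = of_bool (n = (0 :: int^'d))"
proof -
  interpret product_sigma_finite "\<lambda>_::real^'d. lborel::real measure"
    by standard
  let ?h = "\<lambda>b t. indicator {- 1 / 2..<1 / 2} t *\<^sub>R exp (2 * complex_of_real pi * \<i> * of_real ((real_vec n \<bullet> b) * t))"
  have [measurable]: "cube_exp n \<in> borel_measurable borel"
    by (intro borel_measurable_continuous_onI continuous_intros)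
  have int: "integrable lborel (?h b)" for b :: "real^'d"
  proof (rule Bochner_Integration.integrable_bound)
    show "integrable lborel (indicator {- 1 / 2..<1 / 2} :: real \<Rightarrow> real)"
      by simp
    show "?h b \<in> borel_measurable lborel"
      by (auto intro!: borel_measurable_continuous_onI borel_measurable_scaleR continuous_intros)
  qed (auto simp: indicator_def)
  have "(\<integral>x. cube_exp n x \<partial>lebesgue_on unit_cube) = (\<integral>x. indicator unit_cube x *\<^sub>R cube_exp n x \<partial>lborel)"
    by (subst integral_restrict_space) (auto intro!: integral_completion)
  \<comment> \<open>Lebesgue measure is the image of the product measure under the map from
    coordinates to vectors.\<close>
  also have "\<dots> = (\<integral>f. indicator unit_cube (\<Sum>b\<in>Basis. f b *\<^sub>R b) *\<^sub>R cube_exp n (\<Sum>b\<in>Basis. f b *\<^sub>R b)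
      \<partial>Pi\<^sub>M Basis (\<lambda>b. lborel))"
    by (subst lborel_eq) (simp add: integral_distr)
  also have "\<dots> = (\<integral>f. (\<Prod>b\<in>Basis. ?h b (f b)) \<partial>Pi\<^sub>M Basis (\<lambda>b. lborel))"
  proof (intro Bochner_Integration.integral_cong refl)
    fix f :: "real^'d \<Rightarrow> real"
    let ?x = "\<Sum>b\<in>Basis. f b *\<^sub>R b"
    have "indicator unit_cube ?x = (\<Prod>b\<in>Basis. indicator {- 1 / 2..<1 / 2} (f b) :: real)"
      by (simp add: indicator_unit_cube)
    moreover have "cube_exp n ?x
        = (\<Prod>b\<in>Basis. exp (2 * complex_of_real pi * \<i> * of_real ((real_vec n \<bullet> b) * f b)))"
      by (simp add: cube_exp_def inner_sum_right sum_distrib_left exp_sum mult.commute)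
    ultimately show "indicator unit_cube ?x *\<^sub>R cube_exp n ?x = (\<Prod>b\<in>Basis. ?h b (f b))"
      by (simp only: scaleR_conv_of_real of_real_prod prod.distrib)
  qed
  also have "\<dots> = (\<Prod>b\<in>Basis. \<integral>t. ?h b t \<partial>lborel)"
    by (rule product_integral_prod[OF finite_Basis int])
  also have "\<dots> = (\<Prod>b\<in>Basis. of_bool (real_vec n \<bullet> b = 0))"
  proof (intro prod.cong refl)
    fix b :: "real^'d" assume "b \<in> Basis"
    then obtain i where "b = axis i 1"
      by (auto simp: Basis_vec_def)
    then have "real_vec n \<bullet> b = of_int (n $ i)"
      by (simp add: inner_axis real_vec_def)
    then show "(\<integral>t. ?h b t \<partial>lborel) = of_bool (real_vec n \<bullet> b = 0)"
      using integral_exp_unit_interval[of "n $ i"] by simp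
  qed
  also have "\<dots> = of_bool (n = 0)"
  proof (cases "n = 0")
    case True
    then show ?thesis
      by (simp add: real_vec_def inner_vec_def)
  next
    case False
    then obtain i where "n $ i \<noteq> 0"
      by (auto simp: vec_eq_iff)
    moreover have "axis i 1 \<in> (Basis :: (real^'d) set)"
      by (auto simp: Basis_vec_def)
    ultimately have "(\<Prod>b\<in>Basis. of_bool (real_vec n \<bullet> b = 0) :: complex) = 0"
      by (intro prod_zero bexI[of _ "axis i 1"]) (simp_all add: inner_axis real_vec_def)
    with False show ?thesis
      by simp
  qed
  finally show ?thesis .
qed

lemma finite_measure_lebesgue_on_unit_cube: "finite_measure (lebesgue_on (unit_cube :: (real^'d) set))"
  by (rule finite_measure_lebesgue_on[OF lmeasurable_unit_cube])

lemma continuous_imp_measurable_lebesgue_on: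
  fixes f :: "'a::euclidean_space \<Rightarrow> 'b::euclidean_space"
  assumes "continuous_on UNIV f"
  shows "f \<in> borel_measurable (lebesgue_on S)"
  using borel_measurable_continuous_onI[OF assms]
  by (metis borel_measurable_if_D measurable_completion measurable_lborel2 measurable_restrict_space1)

interpretation cube: orthonormal_system "lebesgue_on (unit_cube :: (real^'d) set)" cube_exp
proof
  show "cube_exp n \<in> L2_space (lebesgue_on unit_cube)" for n :: "int^'d"
    by (rule L2_space_bounded[OF finite_measure_lebesgue_on_unit_cube, of _ 1])
      (auto intro: continuous_imp_measurable_lebesgue_on continuous_intros)
  show "L2_inner (lebesgue_on unit_cube) (cube_exp m) (cube_exp n) = of_bool (m = n)" for m n :: "int^'d"
    by (simp add: L2_inner_def cnj_cube_exp cube_exp_mult integral_cube_exp)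
qed

section \<open>Density of the trigonometric polynomials\<close>

definition trig_poly :: "(real^'d \<Rightarrow> complex) \<Rightarrow> bool" where
  "trig_poly f \<longleftrightarrow> (\<exists>J a. finite J \<and> f = (\<lambda>x. \<Sum>n\<in>J. a n * cube_exp n x))"

lemma trig_polyE:
  assumes "trig_poly f"
  obtains J a where "finite J" "f = (\<lambda>x. \<Sum>n\<in>J. a n * cube_exp n x)"
  using assms unfolding trig_poly_def by auto

lemma trig_poly_cube_exp: "trig_poly (\<lambda>x. c * cube_exp n x)"
  unfolding trig_poly_def by (intro exI[of _ "{n}"] exI[of _ "\<lambda>_. c"]) simp

lemma trig_poly_const: "trig_poly (\<lambda>x. c)"
  using trig_poly_cube_exp[of c 0] by (simp add: cube_exp_def real_vec_def inner_vec_def)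

lemma trig_poly_add:
  assumes "trig_poly f" "trig_poly g"
  shows "trig_poly (\<lambda>x. f x + g x)"
proof -
  obtain J a where J: "finite J" "f = (\<lambda>x. \<Sum>n\<in>J. a n * cube_exp n x)"
    using assms(1) by (rule trig_polyE)
  obtain K b where K: "finite K" "g = (\<lambda>x. \<Sum>n\<in>K. b n * cube_exp n x)"
    using assms(2) by (rule trig_polyE)
  \<comment> \<open>Both sums are padded with zero coefficients to a common index set.\<close>
  have "f = (\<lambda>x. \<Sum>n\<in>J \<union> K. of_bool (n \<in> J) * a n * cube_exp n x)"
    unfolding J(2) using J(1) K(1) by (intro ext sum.mono_neutral_cong_left) auto
  moreover have "g = (\<lambda>x. \<Sum>n\<in>J \<union> K. of_bool (n \<in> K) * b n * cube_exp n x)"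
    unfolding K(2) using J(1) K(1) by (intro ext sum.mono_neutral_cong_left) auto
  ultimately have "(\<lambda>x. f x + g x) =
      (\<lambda>x. \<Sum>n\<in>J \<union> K. (of_bool (n \<in> J) * a n + of_bool (n \<in> K) * b n) * cube_exp n x)"
    by (simp only: distrib_right sum.distrib)
  then show ?thesis
    unfolding trig_poly_def using J(1) K(1) by (intro exI conjI) auto
qed

lemma trig_poly_sum:
  assumes "\<And>k. k \<in> J \<Longrightarrow> trig_poly (f k)"
  shows "trig_poly (\<lambda>x. \<Sum>k\<in>J. f k x)"
  using assms
  by (induction J rule: infinite_finite_induct) (auto intro: trig_poly_const trig_poly_add)

lemma trig_poly_mult:
  assumes "trig_poly f" "trig_poly g"
  shows "trig_poly (\<lambda>x. f x * g x)"
proof -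
  obtain J a where J: "f = (\<lambda>x. \<Sum>n\<in>J. a n * cube_exp n x)"
    using assms(1) by (rule trig_polyE)
  obtain K b where K: "g = (\<lambda>x. \<Sum>n\<in>K. b n * cube_exp n x)"
    using assms(2) by (rule trig_polyE)
  have "f x * g x = (\<Sum>m\<in>J. \<Sum>n\<in>K. (a m * b n) * cube_exp (m + n) x)" for x
    unfolding J K sum_product cube_exp_mult[symmetric] by (simp add: mult_ac)
  then show ?thesis
    by (simp add: trig_poly_sum trig_poly_cube_exp)
qed

lemma trig_poly_L2: "trig_poly f \<Longrightarrow> f \<in> L2_space (lebesgue_on unit_cube)"
  unfolding trig_poly_def by (auto intro!: L2_space_sum L2_space_mult cube.L2)

section \<open>Uniform approximation by passing to the torus\<close>

definition torus_map :: "real^'d \<Rightarrow> complex^'d" where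
  "torus_map x = (\<chi> i. exp (2 * complex_of_real pi * \<i> * of_real (x $ i)))"

lemma torus_map_nth: "torus_map x $ i = cube_exp (axis i 1) x"
proof -
  have "real_vec (axis i 1) = axis i 1"
    by (simp add: real_vec_def axis_def vec_eq_iff)
  then show ?thesis
    by (simp add: torus_map_def cube_exp_def inner_axis')
qed

lemma continuous_on_torus_map: "continuous_on S torus_map"
  unfolding torus_map_def[abs_def] by (intro continuous_intros)

lemma torus_map_eq_imp:
  assumes "torus_map x = torus_map y"
  shows "x $ i - y $ i \<in> \<int>"
proof -
  have "exp (2 * complex_of_real pi * \<i> * of_real (x $ i)) = exp (2 * complex_of_real pi * \<i> * of_real (y $ i))"
    using assms by (simp add: torus_map_def vec_eq_iff)
  then obtain k :: int where "2 * complex_of_real pi * \<i> * of_real (x $ i)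
      = 2 * complex_of_real pi * \<i> * of_real (y $ i) + (of_int (2 * k) * pi) * \<i>"
    unfolding exp_eq by blast
  then have "2 * complex_of_real pi * \<i> * of_real (x $ i - y $ i - of_int k) = 0"
    by (simp add: algebra_simps)
  then have "x $ i - y $ i = of_int k"
    by (simp del: of_real_diff)
  then show ?thesis
    by simp
qed

text \<open>The torus lies in complex space, and the real and imaginary parts of its coordinates are
  combinations of an exponential and its conjugate. So linear functionals pull back to trigonometric
  polynomials, and sums and products preserve this.\<close>

lemma trig_poly_real_polynomial_torus_map:
  assumes "real_polynomial_function p"
  shows "trig_poly (\<lambda>x. complex_of_real (p (torus_map x)))"
  using assms
proof (induction p rule: real_polynomial_function.induct)
  case (linear p)
  then interpret bounded_linear p .
  \<comment> \<open>The functional \<open>p\<close> is only real-linear, so its values at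
    \<open>axis i 1\<close> and at \<open>axis i \<i>\<close> are both needed.\<close>
  have decomp: "z = (\<Sum>i\<in>UNIV. Re (z $ i) *\<^sub>R axis i 1 + Im (z $ i) *\<^sub>R axis i \<i>)" for z :: "complex^'a"
  proof -
    have "(Re (z $ i) *\<^sub>R axis i 1 + Im (z $ i) *\<^sub>R axis i \<i>) $ j = (if i = j then z $ i else 0)" for i j
      by (auto simp: axis_def complex_eq_iff)
    then show ?thesis
      unfolding vec_eq_iff sum_component by simp
  qed
  have Re_Im: "complex_of_real (Re w) = 1 / 2 * w + 1 / 2 * cnj w"
    "complex_of_real (Im w) = - \<i> / 2 * w + \<i> / 2 * cnj w" for w
    by (simp_all add: complex_eq_iff)
  have p: "p z = (\<Sum>i\<in>UNIV. p (axis i 1) * Re (z $ i) + p (axis i \<i>) * Im (z $ i))" for z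
    by (subst decomp) (simp only: sum add scaleR real_scaleR_def mult.commute)
  have "complex_of_real (p (torus_map x)) = (\<Sum>i\<in>UNIV.
      of_real (p (axis i 1)) * (1 / 2 * cube_exp (axis i 1) x + 1 / 2 * cube_exp (- axis i 1) x)
      + of_real (p (axis i \<i>)) * (- \<i> / 2 * cube_exp (axis i 1) x + \<i> / 2 * cube_exp (- axis i 1) x))" for x
    by (subst p) (simp only: of_real_sum of_real_add of_real_mult Re_Im torus_map_nth cnj_cube_exp)
  then show ?case
    by (simp only: trig_poly_sum trig_poly_add trig_poly_mult trig_poly_const trig_poly_cube_exp)
qed (simp_all add: trig_poly_const trig_poly_add trig_poly_mult)

abbreviation closed_cube :: "(real^'d) set" where "closed_cube \<equiv> cbox (\<chi> i. - 1 / 2) (\<chi> i. 1 / 2)"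
abbreviation open_cube :: "(real^'d) set" where "open_cube \<equiv> box (\<chi> i. - 1 / 2) (\<chi> i. 1 / 2)"

text \<open>Two identified points differ by a nonzero integer in some coordinate. Both values lie in
  an interval of length 1, so they are its two endpoints.\<close>

lemma torus_map_fibre:
  assumes "x \<in> closed_cube" "y \<in> closed_cube" "torus_map x = torus_map y" "x \<noteq> y"
  shows "x \<notin> open_cube"
proof -
  obtain i where i: "x $ i \<noteq> y $ i"
    using assms(4) by (auto simp: vec_eq_iff)
  obtain k where k: "x $ i - y $ i = of_int k"
    using torus_map_eq_imp[OF assms(3), of i] unfolding Ints_def by auto
  have b: "- 1 / 2 \<le> x $ i" "x $ i \<le> 1 / 2" "- 1 / 2 \<le> y $ i" "y $ i \<le> 1 / 2"
    using assms(1,2) by (auto simp: mem_box_cart)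
  have "k \<noteq> 0"
    using i k by auto
  then have "k \<ge> 1 \<or> k \<le> -1"
    by linarith
  then have "(of_int k :: real) \<ge> 1 \<or> (of_int k :: real) \<le> -1"
    by linarith
  then have "x $ i = 1 / 2 \<or> x $ i = - 1 / 2"
    using k b by linarith
  then show ?thesis
    by (auto simp: mem_box_cart intro!: exI[of _ i])
qed

text \<open>
  A function vanishing on the boundary of the cube descends along \<open>torus_map\<close> to the torus,
  where Stone--Weierstrass applies; polynomials on the torus pull back to trigonometric polynomials.
\<close>

lemma trig_poly_uniform_approx:
  fixes \<phi> :: "real^'d \<Rightarrow> real"
  assumes cont: "continuous_on closed_cube \<phi>"
    and zero: "\<And>x. x \<in> closed_cube - open_cube \<Longrightarrow> \<phi> x = 0" and "e > 0"
  obtains P where "trig_poly P" "\<And>x. x \<in> closed_cube \<Longrightarrow> cmod (of_real (\<phi> x) - P x) < e"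
proof -
  define T :: "(complex^'d) set" where "T = torus_map ` closed_cube"
  \<comment> \<open>The choice of preimage is immaterial: two different preimages in the closed cube
    both lie on its boundary, where \<open>\<phi>\<close> is 0.\<close>
  define F where "F z = \<phi> (SOME x. x \<in> closed_cube \<and> torus_map x = z)" for z
  have F: "F (torus_map x) = \<phi> x" if x: "x \<in> closed_cube" for x
  proof -
    define y where "y = (SOME y. y \<in> closed_cube \<and> torus_map y = torus_map x)"
    have y: "y \<in> closed_cube \<and> torus_map y = torus_map x"
      unfolding y_def by (rule someI[of _ x]) (use x in simp)
    have "\<phi> y = \<phi> x"
    proof (cases "x = y")
      case False
      then have "x \<notin> open_cube" "y \<notin> open_cube"
        using torus_map_fibre[OF x, of y] torus_map_fibre[of y, OF _ x] y by simp_all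
      then show ?thesis
        using zero[of x] zero[of y] x y by simp
    qed simp
    then show ?thesis
      by (simp add: F_def y_def)
  qed
  have "compact T"
    unfolding T_def by (intro compact_continuous_image continuous_on_torus_map compact_cbox)
  \<comment> \<open>The preimage of a closed set under \<open>F\<close> is the torus image of a
    compact set, hence closed; thus continuity descends from the cube to \<open>T\<close>.\<close>
  have "continuous_on T F"
    unfolding continuous_on_closed_vimage[OF compact_imp_closed[OF \<open>compact T\<close>]]
  proof (intro allI impI)
    fix B :: "real set" assume "closed B"
    then have "compact (closed_cube \<inter> \<phi> -` B)"
      using continuous_closed_preimage[OF cont closed_cbox \<open>closed B\<close>] compact_cbox
      by (metis compact_Int_closed Int_left_absorb)
    then have "compact (torus_map ` (closed_cube \<inter> \<phi> -` B))"
      by (intro compact_continuous_image continuous_on_torus_map)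
    moreover have "F -` B \<inter> T = torus_map ` (closed_cube \<inter> \<phi> -` B)"
      using F by (auto simp: T_def)
    ultimately show "closed (F -` B \<inter> T)"
      by (simp add: compact_imp_closed)
  qed
  obtain p where p: "real_polynomial_function p" "\<And>z. z \<in> T \<Longrightarrow> \<bar>F z - p z\<bar> < e"
    by (rule Stone_Weierstrass_real_polynomial_function[OF \<open>compact T\<close> \<open>continuous_on T F\<close> \<open>e > 0\<close>]) (blast intro: that)
  show thesis
  proof
    show "trig_poly (\<lambda>x. complex_of_real (p (torus_map x)))"
      by (rule trig_poly_real_polynomial_torus_map[OF p(1)])
    show "cmod (of_real (\<phi> x) - of_real (p (torus_map x))) < e" if "x \<in> closed_cube" for x
      using p(2)[of "torus_map x"] F[OF that] that
      by (simp add: T_def flip: of_real_diff)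
  qed
qed

section \<open>Approximation in mean square\<close>

definition trig_dense :: "(real^'d \<Rightarrow> complex) \<Rightarrow> bool" where
  "trig_dense f \<longleftrightarrow> (\<forall>\<epsilon>>0. \<exists>P. trig_poly P \<and> (\<integral>x. (cmod (f x - P x))\<^sup>2 \<partial>lebesgue_on unit_cube) < \<epsilon>)"

lemma trig_denseE:
  assumes "trig_dense f" "\<epsilon> > 0"
  obtains P where "trig_poly P" "(\<integral>x. (cmod (f x - P x))\<^sup>2 \<partial>lebesgue_on unit_cube) < \<epsilon>"
  using assms unfolding trig_dense_def by auto

lemma integral_cmod_power2_triangle:
  assumes "f \<in> L2_space M" "g \<in> L2_space M"
  shows "(\<integral>x. (cmod (f x + g x))\<^sup>2 \<partial>M) \<le> 2 * (\<integral>x. (cmod (f x))\<^sup>2 \<partial>M) + 2 * (\<integral>x. (cmod (g x))\<^sup>2 \<partial>M)"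
proof -
  note [simp] = L2_space_integrable[OF assms(1)] L2_space_integrable[OF assms(2)]
  have "(\<integral>x. (cmod (f x + g x))\<^sup>2 \<partial>M) \<le> (\<integral>x. 2 * (cmod (f x))\<^sup>2 + 2 * (cmod (g x))\<^sup>2 \<partial>M)"
    by (intro integral_mono L2_space_integrable L2_space_add assms cmod_add_power2_le) simp
  then show ?thesis
    by simp
qed

text \<open>The square-integrable functions with \<open>trig_dense\<close> form the closure of the
  trigonometric polynomials, and a closure contains its limits.\<close>

lemma trig_dense_limit:
  assumes f: "f \<in> L2_space (lebesgue_on unit_cube)"
    and lim: "\<And>\<epsilon>. \<epsilon> > 0 \<Longrightarrow> \<exists>g \<in> L2_space (lebesgue_on unit_cube). trig_dense g \<and>
      (\<integral>x. (cmod (f x - g x))\<^sup>2 \<partial>lebesgue_on unit_cube) < \<epsilon>"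
  shows "trig_dense f"
  unfolding trig_dense_def
proof (intro allI impI)
  fix \<epsilon> :: real assume "\<epsilon> > 0"
  \<comment> \<open>The triangle inequality for squared norms costs a factor 2 on each of two terms,
    hence a quarter of \<open>\<epsilon>\<close> for each.\<close>
  then obtain g where g: "g \<in> L2_space (lebesgue_on unit_cube)" "trig_dense g"
    "(\<integral>x. (cmod (f x - g x))\<^sup>2 \<partial>lebesgue_on unit_cube) < \<epsilon> / 4"
    using lim[of "\<epsilon> / 4"] by auto
  obtain P where P: "trig_poly P" "(\<integral>x. (cmod (g x - P x))\<^sup>2 \<partial>lebesgue_on unit_cube) < \<epsilon> / 4"
    using \<open>\<epsilon> > 0\<close> by (auto intro: trig_denseE[OF g(2), of "\<epsilon> / 4"])
  have "(\<integral>x. (cmod (f x - P x))\<^sup>2 \<partial>lebesgue_on unit_cube) < \<epsilon>"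
    using integral_cmod_power2_triangle[OF L2_space_diff[OF f g(1)] L2_space_diff[OF g(1) trig_poly_L2[OF P(1)]]]
      g(3) P(2) by simp
  with P(1) show "\<exists>P. trig_poly P \<and> (\<integral>x. (cmod (f x - P x))\<^sup>2 \<partial>lebesgue_on unit_cube) < \<epsilon>"
    by blast
qed

lemma trig_dense_trig_poly: "trig_poly P \<Longrightarrow> trig_dense P"
  unfolding trig_dense_def by (intro allI impI exI[of _ P]) simp

lemma trig_dense_add:
  assumes f: "f \<in> L2_space (lebesgue_on unit_cube)" "trig_dense f"
    and g: "g \<in> L2_space (lebesgue_on unit_cube)" "trig_dense g"
  shows "trig_dense (\<lambda>x. f x + g x)"
  unfolding trig_dense_def
proof (intro allI impI)
  fix \<epsilon> :: real assume "\<epsilon> > 0"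
  then have \<epsilon>: "\<epsilon> / 4 > 0"
    by simp
  obtain P where P: "trig_poly P" "(\<integral>x. (cmod (f x - P x))\<^sup>2 \<partial>lebesgue_on unit_cube) < \<epsilon> / 4"
    by (rule trig_denseE[OF f(2) \<epsilon>])
  obtain Q where Q: "trig_poly Q" "(\<integral>x. (cmod (g x - Q x))\<^sup>2 \<partial>lebesgue_on unit_cube) < \<epsilon> / 4"
    by (rule trig_denseE[OF g(2) \<epsilon>])
  have "(\<integral>x. (cmod ((f x + g x) - (P x + Q x)))\<^sup>2 \<partial>lebesgue_on unit_cube) < \<epsilon>"
    using integral_cmod_power2_triangle[OF L2_space_diff[OF f(1) trig_poly_L2[OF P(1)]]
        L2_space_diff[OF g(1) trig_poly_L2[OF Q(1)]]] P(2) Q(2)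
    by (simp add: add_diff_add)
  with trig_poly_add[OF P(1) Q(1)]
  show "\<exists>P. trig_poly P \<and> (\<integral>x. (cmod (f x + g x - P x))\<^sup>2 \<partial>lebesgue_on unit_cube) < \<epsilon>"
    by (intro exI[of _ "\<lambda>x. P x + Q x"]) simp
qed

lemma trig_dense_mult:
  assumes "trig_dense f"
  shows "trig_dense (\<lambda>x. c * f x)"
  unfolding trig_dense_def
proof (intro allI impI)
  fix \<epsilon> :: real assume "\<epsilon> > 0"
  \<comment> \<open>The summand 1 keeps the divisor positive when \<open>c\<close> is 0.\<close>
  have pos: "(cmod c)\<^sup>2 + 1 > 0"
    by (simp add: add_nonneg_pos)
  obtain P where P: "trig_poly P"
      "(\<integral>x. (cmod (f x - P x))\<^sup>2 \<partial>lebesgue_on unit_cube) < \<epsilon> / ((cmod c)\<^sup>2 + 1)" (is "?I < _")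
    using trig_denseE[OF assms, of "\<epsilon> / ((cmod c)\<^sup>2 + 1)"] \<open>\<epsilon> > 0\<close> pos by auto
  have "(\<integral>x. (cmod (c * f x - c * P x))\<^sup>2 \<partial>lebesgue_on unit_cube) = (cmod c)\<^sup>2 * ?I"
    by (simp add: norm_mult power_mult_distrib flip: right_diff_distrib)
  also have "\<dots> \<le> ((cmod c)\<^sup>2 + 1) * ?I"
    by (intro mult_right_mono) simp_all
  also have "\<dots> < \<epsilon>"
    using P(2) pos by (simp add: field_simps)
  finally show "\<exists>P. trig_poly P \<and> (\<integral>x. (cmod (c * f x - P x))\<^sup>2 \<partial>lebesgue_on unit_cube) < \<epsilon>"
    using trig_poly_mult[OF trig_poly_const P(1)] by (intro exI[of _ "\<lambda>x. c * P x"]) simp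
qed

lemma trig_dense_sum:
  assumes "\<And>k. k \<in> J \<Longrightarrow> f k \<in> L2_space (lebesgue_on unit_cube) \<and> trig_dense (f k)"
  shows "trig_dense (\<lambda>x. \<Sum>k\<in>J. f k x)"
  using assms
proof (induction J rule: infinite_finite_induct)
  case (insert j J)
  then have "trig_dense (\<lambda>x. f j x + (\<Sum>k\<in>J. f k x))"
    by (intro trig_dense_add L2_space_sum) auto
  with insert.hyps show ?case
    by simp
qed (simp_all add: trig_dense_trig_poly trig_poly_const)

lemma L2_indicator:
  assumes "A \<in> sets (lebesgue_on (unit_cube :: (real^'d) set))"
  shows "indicator A \<in> L2_space (lebesgue_on (unit_cube :: (real^'d) set))"
  by (rule L2_space_bounded[OF finite_measure_lebesgue_on_unit_cube, of _ 1])
    (use assms in \<open>auto simp: indicator_def\<close>)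

text \<open>On a set of finite measure, uniform approximation implies approximation in mean
  square.\<close>

lemma trig_dense_continuous:
  fixes \<phi> :: "real^'d \<Rightarrow> real"
  assumes cont: "continuous_on UNIV \<phi>"
    and zero: "\<And>x. x \<in> closed_cube - open_cube \<Longrightarrow> \<phi> x = 0"
  shows "trig_dense (\<lambda>x. of_real (\<phi> x))"
  unfolding trig_dense_def
proof (intro allI impI)
  fix \<epsilon> :: real assume "\<epsilon> > 0"
  interpret finite_measure "lebesgue_on (unit_cube :: (real^'d) set)"
    by (rule finite_measure_lebesgue_on_unit_cube)
  \<comment> \<open>The volume of the cube is read off from the norm of the constant
    exponential.\<close>
  have one: "measure (lebesgue_on (unit_cube :: (real^'d) set)) unit_cube = 1"
    using cube.norm_sum_power2[of "{0}" "\<lambda>_. 1"] by (simp add: power2_eq_square)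
  obtain P where P: "trig_poly P" "\<And>x. x \<in> closed_cube \<Longrightarrow> cmod (of_real (\<phi> x) - P x) < sqrt (\<epsilon> / 2)"
    by (rule trig_poly_uniform_approx[OF continuous_on_subset[OF cont] zero, of "sqrt (\<epsilon> / 2)"])
      (use \<open>\<epsilon> > 0\<close> in auto)
  have "(\<integral>x. (cmod (of_real (\<phi> x) - P x))\<^sup>2 \<partial>lebesgue_on unit_cube)
      \<le> (\<integral>x. \<epsilon> / 2 \<partial>lebesgue_on (unit_cube :: (real^'d) set))"
  proof (rule integral_mono')
    fix x :: "real^'d" assume "x \<in> space (lebesgue_on unit_cube)"
    then have "cmod (of_real (\<phi> x) - P x) \<le> sqrt (\<epsilon> / 2)"
      using P(2)[of x] by (auto simp: unit_cube_eq)
    then have "(cmod (of_real (\<phi> x) - P x))\<^sup>2 \<le> (sqrt (\<epsilon> / 2))\<^sup>2"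
      by (intro power_mono) auto
    then show "(cmod (of_real (\<phi> x) - P x))\<^sup>2 \<le> \<epsilon> / 2"
      using \<open>\<epsilon> > 0\<close> by simp
  qed (use \<open>\<epsilon> > 0\<close> in simp_all)
  also have "\<dots> < \<epsilon>"
    using \<open>\<epsilon> > 0\<close> by (simp add: one)
  finally show "\<exists>P. trig_poly P \<and> (\<integral>x. (cmod (of_real (\<phi> x) - P x))\<^sup>2 \<partial>lebesgue_on unit_cube) < \<epsilon>"
    using P(1) by blast
qed

text \<open>By regularity of Lebesgue measure and Urysohn's lemma, the indicator is approximated by
  a continuous function that vanishes on the boundary of the cube.\<close>

lemma trig_dense_indicator:
  assumes "A \<in> sets (lebesgue_on (unit_cube :: (real^'d) set))"
  shows "trig_dense (indicator A :: real^'d \<Rightarrow> complex)"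
proof (rule trig_dense_limit[OF L2_indicator[OF assms]])
  fix \<epsilon> :: real assume "\<epsilon> > 0"
  have A: "A \<in> sets lebesgue" "A \<subseteq> unit_cube"
    using assms lmeasurable_unit_cube by (auto simp: sets_restrict_space_iff fmeasurableD)
  \<comment> \<open>Dropping boundary points changes \<open>A\<close> by a null set and keeps
    \<open>K\<close> inside the open cube. So \<open>K\<close> is disjoint from the closed
    complement of \<open>U \<inter> open_cube\<close>, as Urysohn's lemma requires.\<close>
  let ?A = "A \<inter> open_cube"
  have A': "?A \<in> sets lebesgue"
    using A(1) by auto
  obtain U where U: "open U" "?A \<subseteq> U" "U - ?A \<in> lmeasurable" "emeasure lebesgue (U - ?A) < ennreal (\<epsilon> / 2)"
    using sets_lebesgue_outer_open[OF A', of "\<epsilon> / 2"] \<open>\<epsilon> > 0\<close> by auto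
  obtain K where K: "closed K" "K \<subseteq> ?A" "?A - K \<in> lmeasurable" "emeasure lebesgue (?A - K) < ennreal (\<epsilon> / 2)"
    using sets_lebesgue_inner_closed[OF A', of "\<epsilon> / 2"] \<open>\<epsilon> > 0\<close> by auto
  obtain \<phi> :: "real^'d \<Rightarrow> real" where \<phi>: "continuous_on UNIV \<phi>" "\<And>x. \<phi> x \<in> closed_segment 1 0"
    "\<And>x. x \<in> K \<Longrightarrow> \<phi> x = 1" "\<And>x. x \<in> - (U \<inter> open_cube) \<Longrightarrow> \<phi> x = 0"
    using U(1,2) K(1,2) by (rule_tac Urysohn[of K "- (U \<inter> open_cube)" 1 0]) auto
  have range: "0 \<le> \<phi> x" "\<phi> x \<le> 1" for x
    using \<phi>(2)[of x] by (auto simp: closed_segment_eq_real_ivl split: if_splits)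
  \<comment> \<open>Within the cube, \<open>\<phi>\<close> agrees with the indicator of
    \<open>A\<close> off this small set; on it the difference is at most 1.\<close>
  let ?E = "(U - ?A) \<union> (?A - K) \<union> (closed_cube - open_cube)"
  have null: "closed_cube - (open_cube :: (real^'d) set) \<in> null_sets lebesgue"
    using negligible_frontier_interval by (simp add: negligible_iff_null_sets)
  have E: "?E \<in> lmeasurable"
    using U(3) K(3) null by (intro fmeasurable.Un) (auto intro: fmeasurableI_null_sets)
  have "measure lebesgue ?E \<le> measure lebesgue (U - ?A) + measure lebesgue (?A - K) + measure lebesgue (closed_cube - (open_cube :: (real^'d) set))"
    using U(3) K(3) null
    by (intro order_trans[OF measure_Un_le] add_right_mono measure_Un_le) (auto intro: fmeasurableD)
  also have "measure lebesgue (U - ?A) < \<epsilon> / 2"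
    using U(3,4) \<open>\<epsilon> > 0\<close> by (simp add: emeasure_eq_measure2 ennreal_less_iff)
  also have "measure lebesgue (?A - K) < \<epsilon> / 2"
    using K(3,4) \<open>\<epsilon> > 0\<close> by (simp add: emeasure_eq_measure2 ennreal_less_iff)
  also have "measure lebesgue (closed_cube - (open_cube :: (real^'d) set)) = 0"
    using null by (simp add: measure_eq_0_null_sets)
  finally have mE: "measure lebesgue ?E < \<epsilon>"
    by simp
  let ?g = "\<lambda>x. complex_of_real (\<phi> x)"
  have le: "indicator unit_cube x * (cmod (indicator A x - ?g x))\<^sup>2 \<le> indicator ?E x" for x
  proof (cases "x \<in> unit_cube \<and> x \<notin> ?E")
    case True
    then have "x \<in> open_cube" "x \<in> A \<Longrightarrow> x \<in> K" "x \<notin> A \<Longrightarrow> x \<notin> U"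
      by (auto simp: unit_cube_eq)
    then have "indicator A x = ?g x"
      using \<phi>(3,4)[of x] K(2) by (auto simp: indicator_def)
    then show ?thesis
      by simp
  next
    case False
    have "cmod (indicator A x - ?g x) \<le> 1"
      using range[of x] by (cases "x \<in> A") (simp_all add: cmod_def)
    then have "(cmod (indicator A x - ?g x))\<^sup>2 \<le> 1"
      by (simp add: power_le_one)
    with False show ?thesis
      by (auto simp: indicator_def)
  qed
  have "(\<integral>x. (cmod (indicator A x - ?g x))\<^sup>2 \<partial>lebesgue_on unit_cube)
      = (\<integral>x. indicator unit_cube x * (cmod (indicator A x - ?g x))\<^sup>2 \<partial>lebesgue)"
    using lmeasurable_unit_cube by (subst integral_restrict_space) (auto intro: fmeasurableD)
  also have "\<dots> \<le> (\<integral>x. indicator ?E x \<partial>lebesgue)"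
    using E le by (intro integral_mono') (auto simp: fmeasurable_def)
  also have "\<dots> < \<epsilon>"
    using mE by simp
  finally have lt: "(\<integral>x. (cmod (indicator A x - ?g x))\<^sup>2 \<partial>lebesgue_on unit_cube) < \<epsilon>" .
  show "\<exists>g \<in> L2_space (lebesgue_on unit_cube). trig_dense g \<and>
      (\<integral>x. (cmod (indicator A x - g x))\<^sup>2 \<partial>lebesgue_on unit_cube) < \<epsilon>"
  proof (intro bexI[of _ ?g] conjI lt)
    show "trig_dense ?g"
      using \<phi>(1,4) by (intro trig_dense_continuous) auto
    show "?g \<in> L2_space (lebesgue_on unit_cube)"
    proof (rule L2_space_bounded[OF finite_measure_lebesgue_on_unit_cube, of _ 1])
      show "?g \<in> borel_measurable (lebesgue_on unit_cube)"
        using \<phi>(1) by (intro continuous_imp_measurable_lebesgue_on continuous_intros)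
    qed (use range in auto)
  qed
qed

text \<open>Simple functions are combinations of indicators, and dominated convergence makes them
  approximate \<open>f\<close> in mean square.\<close>

lemma trig_dense_L2:
  fixes f :: "real^'d \<Rightarrow> complex"
  assumes f: "f \<in> L2_space (lebesgue_on unit_cube)"
  shows "trig_dense f"
proof (rule trig_dense_limit[OF f])
  fix \<epsilon> :: real assume "\<epsilon> > 0"
  let ?M = "lebesgue_on (unit_cube :: (real^'d) set)"
  have [measurable]: "f \<in> borel_measurable ?M"
    by (rule L2_space_measurable[OF f])
  obtain F where "\<forall>i. simple_function ?M (F i)" "\<forall>x\<in>space ?M. (\<lambda>i. F i x) \<longlonglongrightarrow> f x"
      "\<forall>i. \<forall>x\<in>space ?M. dist (F i x) 0 \<le> 2 * dist (f x) 0"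
    using borel_measurable_implies_sequence_metric[OF L2_space_measurable[OF f], of 0]
    by (elim exE conjE)
  then have F: "\<And>i. simple_function ?M (F i)"
      "\<And>x. x \<in> unit_cube \<Longrightarrow> (\<lambda>i. F i x) \<longlonglongrightarrow> f x"
      "\<And>i x. x \<in> unit_cube \<Longrightarrow> dist (F i x) 0 \<le> 2 * dist (f x) 0"
    by auto
  have [measurable]: "F i \<in> borel_measurable ?M" for i
    by (rule borel_measurable_simple_function[OF F(1)])
  have "(\<lambda>i. \<integral>x. (cmod (f x - F i x))\<^sup>2 \<partial>?M) \<longlonglongrightarrow> (\<integral>x. 0 \<partial>?M)"
  proof (rule integral_dominated_convergence)
    \<comment> \<open>The approximants are bounded by twice \<open>f\<close>, so the error is at
      most three times \<open>f\<close> in modulus; 9 is the square of 3.\<close>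
    show "integrable ?M (\<lambda>x. 9 * (cmod (f x))\<^sup>2)"
      using L2_space_integrable[OF f] by simp
    show "AE x in ?M. (\<lambda>i. (cmod (f x - F i x))\<^sup>2) \<longlonglongrightarrow> 0"
    proof (rule AE_I2)
      fix x assume "x \<in> space ?M"
      then have "(\<lambda>i. (cmod (f x - F i x))\<^sup>2) \<longlonglongrightarrow> (cmod (f x - f x))\<^sup>2"
        by (intro tendsto_intros F(2)) simp
      then show "(\<lambda>i. (cmod (f x - F i x))\<^sup>2) \<longlonglongrightarrow> 0"
        by simp
    qed
    show "AE x in ?M. norm ((cmod (f x - F i x))\<^sup>2) \<le> 9 * (cmod (f x))\<^sup>2" for i
    proof (rule AE_I2)
      fix x assume "x \<in> space ?M"
      then have "cmod (f x - F i x) \<le> 3 * cmod (f x)"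
        using F(3)[of x i] norm_triangle_ineq4[of "f x" "F i x"] by simp
      then have "(cmod (f x - F i x))\<^sup>2 \<le> (3 * cmod (f x))\<^sup>2"
        by (intro power_mono) auto
      then show "norm ((cmod (f x - F i x))\<^sup>2) \<le> 9 * (cmod (f x))\<^sup>2"
        by (simp add: power_mult_distrib)
    qed
  qed auto
  then have "\<forall>\<^sub>F i in sequentially. (\<integral>x. (cmod (f x - F i x))\<^sup>2 \<partial>?M) < \<epsilon>"
    using \<open>\<epsilon> > 0\<close> by (intro order_tendstoD) auto
  then obtain i where i: "(\<integral>x. (cmod (f x - F i x))\<^sup>2 \<partial>?M) < \<epsilon>"
    using eventually_happens'[OF sequentially_bot] by auto
  \<comment> \<open>The simple function in canonical form, which agrees with \<open>F i\<close> on
    the cube.\<close>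
  let ?g = "\<lambda>x. \<Sum>y\<in>F i ` unit_cube. y * indicator (F i -` {y} \<inter> unit_cube) x"
  have fin: "finite (F i ` unit_cube)" and sets: "F i -` {y} \<inter> unit_cube \<in> sets ?M" for y
    using simple_functionD[OF F(1)[of i]] by auto
  have "?g x = F i x" if "x \<in> unit_cube" for x
  proof -
    have "?g x = (\<Sum>y\<in>F i ` unit_cube. if y = F i x then y else 0)"
      using that by (intro sum.cong) (auto simp: indicator_def)
    then show ?thesis
      using fin that by simp
  qed
  then have "(\<integral>x. (cmod (f x - ?g x))\<^sup>2 \<partial>?M) = (\<integral>x. (cmod (f x - F i x))\<^sup>2 \<partial>?M)"
    by (intro Bochner_Integration.integral_cong refl) auto
  with i have lt: "(\<integral>x. (cmod (f x - ?g x))\<^sup>2 \<partial>?M) < \<epsilon>"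
    by simp
  show "\<exists>g \<in> L2_space ?M. trig_dense g \<and> (\<integral>x. (cmod (f x - g x))\<^sup>2 \<partial>?M) < \<epsilon>"
    by (intro bexI[of _ ?g] conjI lt trig_dense_sum L2_space_sum L2_space_mult trig_dense_mult
        L2_indicator trig_dense_indicator sets)
qed

lemma Parseval_unit_cube:
  fixes f :: "real^'d \<Rightarrow> complex"
  assumes "f \<in> L2_space (lebesgue_on unit_cube)"
  shows "((\<lambda>n. (cmod (L2_inner (lebesgue_on unit_cube) f (cube_exp n)))\<^sup>2) has_sum
    (\<integral>x. (cmod (f x))\<^sup>2 \<partial>lebesgue_on unit_cube)) UNIV"
proof (rule cube.Parseval[OF assms])
  fix \<epsilon> :: real assume "\<epsilon> > 0"
  then obtain P where "trig_poly P" "(\<integral>x. (cmod (f x - P x))\<^sup>2 \<partial>lebesgue_on unit_cube) < \<epsilon>"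
    by (rule trig_denseE[OF trig_dense_L2[OF assms]])
  then show "\<exists>J a. finite J \<and>
      (\<integral>x. (cmod (f x - (\<Sum>n\<in>J. a n * cube_exp n x)))\<^sup>2 \<partial>lebesgue_on unit_cube) < \<epsilon>"
    unfolding trig_poly_def by auto
qed

section \<open>Unions of translated cubes\<close>

lemma
  fixes t :: "'a::euclidean_space"
  shows measurable_lebesgue_translation: "(\<lambda>x. x + t) \<in> lebesgue \<rightarrow>\<^sub>M lebesgue"
    and distr_lebesgue_translation: "distr lebesgue lebesgue (\<lambda>x. x + t) = lebesgue"
proof -
  have T: "(\<lambda>x. t + (\<Sum>j\<in>Basis. (1 * (x \<bullet> j)) *\<^sub>R j)) = (\<lambda>x. x + t)"
    by (simp add: euclidean_representation add.commute)
  show "(\<lambda>x. x + t) \<in> lebesgue \<rightarrow>\<^sub>M lebesgue"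
    using lebesgue_affine_measurable[of "\<lambda>_. 1" t] unfolding T by simp
  show "distr lebesgue lebesgue (\<lambda>x. x + t) = lebesgue"
    using lebesgue_affine_euclidean[of "\<lambda>_. 1" t] unfolding T by (simp add: density_1)
qed

lemma
  fixes h :: "'a::euclidean_space \<Rightarrow> 'b::{banach, second_countable_topology}"
  assumes "h \<in> borel_measurable lebesgue"
  shows integral_lebesgue_translation: "(\<integral>x. h (x + t) \<partial>lebesgue) = (\<integral>x. h x \<partial>lebesgue)"
    and integrable_lebesgue_translation: "integrable lebesgue (\<lambda>x. h (x + t)) \<longleftrightarrow> integrable lebesgue h"
  using integral_distr[OF measurable_lebesgue_translation assms, of t]
    integrable_distr_eq[OF measurable_lebesgue_translation assms, of t]
  unfolding distr_lebesgue_translation by simp_all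

lemma mem_translate_unit_cube: "x \<in> (\<lambda>x. x + v) ` unit_cube \<longleftrightarrow> x - v \<in> unit_cube"
  by (auto intro: image_eqI[of _ _ "x - v"])

lemma lmeasurable_translate_unit_cube: "(\<lambda>x. x + v) ` unit_cube \<in> lmeasurable"
  using measurable_translation[OF lmeasurable_unit_cube, of v] by (simp add: add.commute)

text \<open>A real number lies in at most one integer translate of a half-open interval of length
  1.\<close>

lemma disjoint_translate_unit_cube:
  assumes "x - real_vec m \<in> unit_cube" "x - real_vec n \<in> unit_cube"
  shows "m = n"
proof -
  have "m $ i = n $ i" for i
  proof -
    have "- 1 / 2 \<le> x $ i - of_int (m $ i)" "x $ i - of_int (m $ i) < 1 / 2"
      "- 1 / 2 \<le> x $ i - of_int (n $ i)" "x $ i - of_int (n $ i) < 1 / 2"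
      using assms by (simp_all add: unit_cube_def real_vec_def)
    then show ?thesis
      by linarith
  qed
  then show ?thesis
    by (simp add: vec_eq_iff)
qed

lemma lmeasurable_cube_union: "cube_union (M :: 'n::finite \<Rightarrow> int^'d) \<in> lmeasurable"
  unfolding cube_union_def by (intro fmeasurable.finite_UN lmeasurable_translate_unit_cube) simp

lemma translate_into_cube_union: "x \<in> unit_cube \<Longrightarrow> x + real_vec (M p) \<in> cube_union M"
  by (auto simp: cube_union_def)

lemma indicator_cube_union:
  fixes M :: "'n::finite \<Rightarrow> int^'d"
  assumes "inj M"
  shows "indicator (cube_union M) x = (\<Sum>p\<in>UNIV. indicator unit_cube (x - real_vec (M p)) :: real)"
proof -
  have "cube_union M = (\<Union>p. {x. x - real_vec (M p) \<in> unit_cube})"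
    unfolding cube_union_def by (auto simp: mem_translate_unit_cube)
  moreover have "indicator (\<Union>p. {x. x - real_vec (M p) \<in> unit_cube}) x
      = (\<Sum>p\<in>UNIV. indicator {x. x - real_vec (M p) \<in> unit_cube} x :: real)"
    using disjoint_translate_unit_cube assms
    by (intro indicator_UN_disjoint) (fastforce simp: disjoint_family_on_def inj_def)+
  ultimately show ?thesis
    by (simp add: indicator_def)
qed

text \<open>The translates are disjoint, so \<open>g\<close> on the union is the sum of its pieces
  \<open>h p\<close>, each supported on one translate and moved back to the unit cube by translation
  invariance.\<close>

lemma
  fixes g :: "real^'d \<Rightarrow> 'b::{banach, second_countable_topology}" and M :: "'n::finite \<Rightarrow> int^'d"
  assumes "inj M" and g: "integrable (lebesgue_on (cube_union M)) g"
  shows integral_cube_union: "(\<integral>x. g x \<partial>lebesgue_on (cube_union M))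
      = (\<Sum>p\<in>UNIV. \<integral>x. g (x + real_vec (M p)) \<partial>lebesgue_on unit_cube)"
    and integrable_translate_cube_union: "integrable (lebesgue_on unit_cube) (\<lambda>x. g (x + real_vec (M p)))"
proof -
  have Q: "cube_union M \<inter> space lebesgue \<in> sets lebesgue" and C: "unit_cube \<inter> space lebesgue \<in> sets lebesgue"
    using lmeasurable_cube_union[of M] lmeasurable_unit_cube by (auto dest: fmeasurableD)
  define h where "h p x = indicator unit_cube (x - real_vec (M p)) *\<^sub>R g x" for p x
  have h: "integrable lebesgue (h p)" for p
  proof -
    have "integrable lebesgue (\<lambda>x. indicator ((\<lambda>x. x + real_vec (M p)) ` unit_cube) x *\<^sub>R
        (indicator (cube_union M) x *\<^sub>R g x))"
      using g unfolding integrable_restrict_space[OF Q]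
      by (rule integrable_mult_indicator[OF fmeasurableD[OF lmeasurable_translate_unit_cube]])
    moreover have "indicator ((\<lambda>x. x + real_vec (M p)) ` unit_cube) x *\<^sub>R (indicator (cube_union M) x *\<^sub>R g x) = h p x" for x
      by (auto simp: h_def indicator_def cube_union_def mem_translate_unit_cube)
    ultimately show ?thesis
      by simp
  qed
  have meas: "h p \<in> borel_measurable lebesgue" for p
    using h by (rule borel_measurable_integrable)
  have shift: "h p (x + real_vec (M p)) = indicator unit_cube x *\<^sub>R g (x + real_vec (M p))" for p x
    by (simp add: h_def)
  show "integrable (lebesgue_on unit_cube) (\<lambda>x. g (x + real_vec (M p)))"
    unfolding integrable_restrict_space[OF C] shift[symmetric] integrable_lebesgue_translation[OF meas] by (rule h)
  have "(\<integral>x. g x \<partial>lebesgue_on (cube_union M)) = (\<integral>x. (\<Sum>p\<in>UNIV. h p x) \<partial>lebesgue)"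
    unfolding integral_restrict_space[OF Q] indicator_cube_union[OF assms(1)] h_def scaleR_sum_left ..
  also have "\<dots> = (\<Sum>p\<in>UNIV. \<integral>x. h p x \<partial>lebesgue)"
    by (intro Bochner_Integration.integral_sum h)
  also have "\<dots> = (\<Sum>p\<in>UNIV. \<integral>x. h p (x + real_vec (M p)) \<partial>lebesgue)"
    by (simp add: integral_lebesgue_translation[OF meas])
  finally show "(\<integral>x. g x \<partial>lebesgue_on (cube_union M))
      = (\<Sum>p\<in>UNIV. \<integral>x. g (x + real_vec (M p)) \<partial>lebesgue_on unit_cube)"
    unfolding shift integral_restrict_space[OF C] .
qed

lemma L2_translate_cube_union:
  fixes M :: "'n::finite \<Rightarrow> int^'d"
  assumes "inj M" and w: "w \<in> L2_space (lebesgue_on (cube_union M))"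
  shows "(\<lambda>x. w (x + real_vec (M p))) \<in> L2_space (lebesgue_on unit_cube)"
proof (rule L2_space_dominated)
  have "(\<lambda>x. x + real_vec (M p)) \<in> lebesgue_on unit_cube \<rightarrow>\<^sub>M lebesgue_on (cube_union M)"
    by (intro measurable_restrict_space3 measurable_lebesgue_translation)
      (auto intro: translate_into_cube_union)
  then show "(\<lambda>x. w (x + real_vec (M p))) \<in> borel_measurable (lebesgue_on unit_cube)"
    using L2_space_measurable[OF w] by (rule measurable_compose)
  show "integrable (lebesgue_on unit_cube) (\<lambda>x. (cmod (w (x + real_vec (M p))))\<^sup>2)"
    by (rule integrable_translate_cube_union[OF assms(1) L2_space_integrable[OF w]])
qed simp

section \<open>Invertible matrices acting on vector fields\<close>

lemma norm_vec_power2: "(norm (v :: complex^'n))\<^sup>2 = (\<Sum>i\<in>UNIV. (cmod (v $ i))\<^sup>2)"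
  by (simp add: norm_vec_def L2_set_def sum_nonneg)

text \<open>The map is viewed as real-linear on a finite-dimensional space, where injectivity gives
  a positive lower bound. Squaring both bounds yields the constants.\<close>

lemma matrix_norm_bounds:
  fixes A :: "complex^'n^'n"
  assumes "det A \<noteq> 0"
  shows "\<exists>a>0. \<exists>b>0. \<forall>v. a * (norm v)\<^sup>2 \<le> (norm (A *v v))\<^sup>2 \<and> (norm (A *v v))\<^sup>2 \<le> b * (norm v)\<^sup>2"
proof -
  have lin: "linear ((*v) A)"
    by (intro linearI) (simp_all add: matrix_vector_mult_def vec_eq_iff algebra_simps sum.distrib scaleR_sum_right)
  obtain B where "B ** A = mat 1"
    using assms unfolding invertible_det_nz[symmetric] invertible_def by auto
  then have "B *v (A *v v) = v" for v
    by (simp add: matrix_vector_mul_assoc)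
  then have "inj ((*v) A)"
    by (metis injI)
  from linear_inj_bounded_below_pos[OF lin this] obtain a where a: "a > 0" "\<And>v. a * norm v \<le> norm (A *v v)"
    by blast
  obtain b where b: "b > 0" "\<And>v. norm (A *v v) \<le> b * norm v"
    using linear_bounded_pos[OF lin] by blast
  show ?thesis
  proof (rule exI[of _ "a\<^sup>2"], rule conjI[OF zero_less_power[OF a(1)]],
      rule exI[of _ "b\<^sup>2"], rule conjI[OF zero_less_power[OF b(1)]], intro allI conjI)
    show "a\<^sup>2 * (norm v)\<^sup>2 \<le> (norm (A *v v))\<^sup>2" for v
      unfolding power_mult_distrib[symmetric] using a by (intro power_mono) auto
    show "(norm (A *v v))\<^sup>2 \<le> b\<^sup>2 * (norm v)\<^sup>2" for v
      unfolding power_mult_distrib[symmetric] using b by (intro power_mono) auto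
  qed
qed

text \<open>The pointwise bounds are integrated. The constants come from the matrix alone, so they
  are uniform in the vector field \<open>V\<close>.\<close>

lemma matrix_L2_bounds:
  fixes A :: "complex^'n^'n" and M :: "'a measure"
  assumes "det A \<noteq> 0"
  shows "\<exists>a>0. \<exists>b>0. \<forall>V. (\<forall>i. (\<lambda>x. V x $ i) \<in> L2_space M) \<longrightarrow>
    a * (\<Sum>i\<in>UNIV. \<integral>x. (cmod (V x $ i))\<^sup>2 \<partial>M) \<le> (\<Sum>i\<in>UNIV. \<integral>x. (cmod ((A *v V x) $ i))\<^sup>2 \<partial>M) \<and>
    (\<Sum>i\<in>UNIV. \<integral>x. (cmod ((A *v V x) $ i))\<^sup>2 \<partial>M) \<le> b * (\<Sum>i\<in>UNIV. \<integral>x. (cmod (V x $ i))\<^sup>2 \<partial>M)"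
proof -
  obtain a b where ab: "a > 0" "b > 0"
    and bounds: "\<And>v. a * (norm v)\<^sup>2 \<le> (norm (A *v v))\<^sup>2" "\<And>v. (norm (A *v v))\<^sup>2 \<le> b * (norm v)\<^sup>2"
    using matrix_norm_bounds[OF assms] by auto
  have norm_eq: "integrable M (\<lambda>x. (norm (V x))\<^sup>2)"
      "(\<Sum>i\<in>UNIV. \<integral>x. (cmod (V x $ i))\<^sup>2 \<partial>M) = (\<integral>x. (norm (V x))\<^sup>2 \<partial>M)"
    if "\<And>i. (\<lambda>x. V x $ i) \<in> L2_space M" for V :: "'a \<Rightarrow> complex^'n"
    unfolding norm_vec_power2 using L2_space_integrable[OF that] by simp_all
  have AV: "(\<lambda>x. (A *v V x) $ i) \<in> L2_space M" if "\<And>i. (\<lambda>x. V x $ i) \<in> L2_space M" for V :: "'a \<Rightarrow> complex^'n" and i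
    unfolding matrix_vector_mult_def using that by (auto intro!: L2_space_sum L2_space_mult)
  show ?thesis
  proof (rule exI[of _ a], rule conjI[OF ab(1)], rule exI[of _ b], rule conjI[OF ab(2)], intro allI impI conjI)
    fix V :: "'a \<Rightarrow> complex^'n" assume "\<forall>i. (\<lambda>x. V x $ i) \<in> L2_space M"
    then have V: "\<And>i :: 'n. (\<lambda>x. V x $ i) \<in> L2_space M"
      by simp
    note eqs = norm_eq[of V, OF V] norm_eq[of "\<lambda>x. A *v V x", OF AV[of V, OF V]]
    show "a * (\<Sum>i\<in>UNIV. \<integral>x. (cmod (V x $ i))\<^sup>2 \<partial>M) \<le> (\<Sum>i\<in>UNIV. \<integral>x. (cmod ((A *v V x) $ i))\<^sup>2 \<partial>M)"
      unfolding eqs(2,4) integral_mult_right_zero[symmetric]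
      by (intro integral_mono bounds) (simp_all add: eqs)
    show "(\<Sum>i\<in>UNIV. \<integral>x. (cmod ((A *v V x) $ i))\<^sup>2 \<partial>M) \<le> b * (\<Sum>i\<in>UNIV. \<integral>x. (cmod (V x $ i))\<^sup>2 \<partial>M)"
      unfolding eqs(2,4) integral_mult_right_zero[symmetric]
      by (intro integral_mono bounds) (simp_all add: eqs)
  qed
qed

section \<open>The exponential system in cube coordinates\<close>

definition exp_matrix :: "('n \<Rightarrow> int^'d) \<Rightarrow> real^'d^'n \<Rightarrow> complex^'n^'n" where
  "exp_matrix M \<delta> = (\<chi> j p. exp (2 * complex_of_real pi * \<i> * of_real (\<delta> $ j \<bullet> real_vec (M p))))"

text \<open>The factor that a shift contributes within one cube. Being unimodular, it disappears
  from all integrals of squared moduli.\<close>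

definition twist :: "real^'d \<Rightarrow> real^'d \<Rightarrow> complex" where
  "twist v x = exp (2 * complex_of_real pi * \<i> * of_real (v \<bullet> x))"

lemma cmod_twist [simp]: "cmod (twist v x) = 1"
  by (simp add: twist_def)

lemma continuous_on_twist [continuous_intros]: "continuous_on S (twist v)"
  unfolding twist_def[abs_def] by (intro continuous_intros)

lemma L2_twist:
  assumes "f \<in> L2_space (lebesgue_on S)"
  shows "(\<lambda>x. f x * twist v x) \<in> L2_space (lebesgue_on S)"
proof (rule L2_space_dominated)
  show "(\<lambda>x. f x * twist v x) \<in> borel_measurable (lebesgue_on S)"
    by (intro borel_measurable_times L2_space_measurable[OF assms]
        continuous_imp_measurable_lebesgue_on continuous_intros)
  show "integrable (lebesgue_on S) (\<lambda>x. (cmod (f x))\<^sup>2)"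
    by (rule L2_space_integrable[OF assms])
qed (simp add: norm_mult)

lemma cnj_twist: "cnj (twist v x) = twist (- v) x"
  by (simp add: twist_def exp_cnj)

lemma exp_int_inner: "exp (2 * complex_of_real pi * \<i> * of_real (real_vec m \<bullet> real_vec n)) = 1"
proof -
  define k where "k = (\<Sum>i\<in>UNIV. m $ i * n $ i)"
  have "real_vec m \<bullet> real_vec n = of_int k"
    by (simp add: k_def inner_vec_def real_vec_def)
  moreover have "exp ((2 * complex_of_int k * of_real pi) * \<i>) = 1"
    using exp_integer_2pi[of "of_int k"] by simp
  ultimately show ?thesis
    by (simp add: mult_ac)
qed

lemma exp_family_eq: "exp_family \<delta> (j, n) x = cube_exp n x * twist (\<delta> $ j) x"
  by (simp add: exp_family_def cube_exp_def twist_def inner_add_left distrib_left exp_add)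

text \<open>The factor coupling \<open>n\<close> with \<open>M p\<close> is 1 because both are
  integer vectors. So \<open>n\<close> enters only through \<open>cube_exp\<close> and
  \<open>p\<close> only through the matrix, which reduces the system to linear algebra over the
  Fourier basis.\<close>

lemma exp_family_translate:
  "exp_family \<delta> (j, n) (x + real_vec (M p)) = cube_exp n x * twist (\<delta> $ j) x * exp_matrix M \<delta> $ j $ p"
  using exp_int_inner[of n "M p"]
  by (simp add: exp_family_eq cube_exp_def twist_def exp_matrix_def inner_add_right distrib_left exp_add)

lemma exp_family_L2: "exp_family \<delta> k \<in> L2_space (lebesgue_on (cube_union (M :: 'n::finite \<Rightarrow> int^'d)))"
proof (cases k)
  case (Pair j n)
  have "exp_family \<delta> (j, n) = (\<lambda>x. cube_exp n x * twist (\<delta> $ j) x)"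
    by (rule ext) (rule exp_family_eq)
  moreover have "(\<lambda>x. cube_exp n x * twist (\<delta> $ j) x) \<in> L2_space (lebesgue_on (cube_union M))"
    by (rule L2_space_bounded[OF finite_measure_lebesgue_on[OF lmeasurable_cube_union], of _ _ 1])
      (auto simp: norm_mult intro!: continuous_imp_measurable_lebesgue_on continuous_intros)
  ultimately show ?thesis
    by (simp add: Pair)
qed

text \<open>For fixed \<open>j\<close> the inner products with the family are the Fourier
  coefficients of one function on the cube, so Parseval turns the frame sum into an integral
  governed by the matrix.\<close>

lemma is_frame_exp_family:
  fixes M :: "'n::finite \<Rightarrow> int^'d"
  assumes "inj M" and det: "det (exp_matrix M \<delta>) \<noteq> 0"
  shows "is_frame (lebesgue_on (cube_union M)) (exp_family \<delta>)"
proof -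
  let ?\<Gamma> = "exp_matrix M \<delta>" and ?Q = "lebesgue_on (cube_union M)" and ?C = "lebesgue_on (unit_cube :: (real^'d) set)"
  obtain a b where ab: "a > 0" "b > 0"
    and bounds: "\<forall>V. (\<forall>i. (\<lambda>x. V x $ i) \<in> L2_space ?C) \<longrightarrow>
      a * (\<Sum>i\<in>UNIV. \<integral>x. (cmod (V x $ i))\<^sup>2 \<partial>?C) \<le> (\<Sum>i\<in>UNIV. \<integral>x. (cmod ((?\<Gamma> *v V x) $ i))\<^sup>2 \<partial>?C) \<and>
      (\<Sum>i\<in>UNIV. \<integral>x. (cmod ((?\<Gamma> *v V x) $ i))\<^sup>2 \<partial>?C) \<le> b * (\<Sum>i\<in>UNIV. \<integral>x. (cmod (V x $ i))\<^sup>2 \<partial>?C)"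
    using matrix_L2_bounds[OF det, of ?C] by (elim exE conjE)
  have "(\<lambda>k. (cmod (L2_inner ?Q w (exp_family \<delta> k)))\<^sup>2) summable_on UNIV \<and>
      a * (L2_norm ?Q w)\<^sup>2 \<le> (\<Sum>\<^sub>\<infinity>k. (cmod (L2_inner ?Q w (exp_family \<delta> k)))\<^sup>2) \<and>
      (\<Sum>\<^sub>\<infinity>k. (cmod (L2_inner ?Q w (exp_family \<delta> k)))\<^sup>2) \<le> b * (L2_norm ?Q w)\<^sup>2"
    if w: "w \<in> L2_space ?Q" for w
  proof -
    define W where "W p x = w (x + real_vec (M p))" for p x
    \<comment> \<open>The inner product conjugates the family. Conjugating \<open>w\<close> instead
      makes the modulus of \<open>G j\<close> that of an entry of the matrix itself applied to
      \<open>V\<close>, up to the unimodular twist.\<close>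
    define V where "V x = (\<chi> p. cnj (W p x))" for x
    define G where "G j x = (\<Sum>p\<in>UNIV. cnj (?\<Gamma> $ j $ p) * W p x) * twist (- \<delta> $ j) x" for j x
    have W: "W p \<in> L2_space ?C" for p
      unfolding W_def[abs_def] by (rule L2_translate_cube_union[OF assms(1) w])
    have V: "(\<lambda>x. V x $ p) \<in> L2_space ?C" for p
    proof (rule L2_space_dominated)
      show "(\<lambda>x. V x $ p) \<in> borel_measurable ?C"
        unfolding V_def
        using measurable_compose[OF L2_space_measurable[OF W] borel_measurable_continuous_onI[of cnj]]
        by (simp add: continuous_intros)
      show "integrable ?C (\<lambda>x. (cmod (W p x))\<^sup>2)"
        by (rule L2_space_integrable[OF W])
    qed (simp add: V_def)
    have G: "G j \<in> L2_space ?C" for j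
      unfolding G_def[abs_def] by (intro L2_twist L2_space_sum L2_space_mult W)
    have cmod_G: "cmod (G j x) = cmod ((?\<Gamma> *v V x) $ j)" for j x
    proof -
      have "cnj ((?\<Gamma> *v V x) $ j) = (\<Sum>p\<in>UNIV. cnj (?\<Gamma> $ j $ p) * W p x)"
        by (simp add: matrix_vector_mult_def V_def)
      then show ?thesis
        unfolding G_def norm_mult cmod_twist by (metis complex_mod_cnj mult.right_neutral)
    qed
    have inner: "L2_inner ?Q w (exp_family \<delta> (j, n)) = L2_inner ?C (G j) (cube_exp n)" for j n
    proof -
      have "L2_inner ?Q w (exp_family \<delta> (j, n))
          = (\<Sum>p\<in>UNIV. \<integral>x. W p x * cnj (exp_family \<delta> (j, n) (x + real_vec (M p))) \<partial>?C)"
        unfolding L2_inner_def W_def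
        by (rule integral_cube_union[OF assms(1) integrable_L2_inner[OF w exp_family_L2]])
      also have "\<dots> = (\<integral>x. (\<Sum>p\<in>UNIV. W p x * cnj (exp_family \<delta> (j, n) (x + real_vec (M p)))) \<partial>?C)"
        unfolding W_def using integrable_translate_cube_union[OF assms(1) integrable_L2_inner[OF w exp_family_L2]]
        by (intro Bochner_Integration.integral_sum[symmetric])
      also have "\<dots> = L2_inner ?C (G j) (cube_exp n)"
        unfolding L2_inner_def
      proof (intro Bochner_Integration.integral_cong refl)
        fix x
        show "(\<Sum>p\<in>UNIV. W p x * cnj (exp_family \<delta> (j, n) (x + real_vec (M p)))) = G j x * cnj (cube_exp n x)"
          unfolding exp_family_translate G_def sum_distrib_right
          by (intro sum.cong refl) (simp add: cnj_twist)
      qed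
      finally show ?thesis .
    qed
    let ?S = "\<Sum>j\<in>UNIV. \<integral>x. (cmod ((?\<Gamma> *v V x) $ j))\<^sup>2 \<partial>?C"
    \<comment> \<open>One Parseval identity for each \<open>j\<close>; the full index set is the
      finite disjoint union of the fibres over \<open>j\<close>.\<close>
    have "((\<lambda>k. (cmod (L2_inner ?Q w (exp_family \<delta> k)))\<^sup>2) has_sum ?S) (\<Union>j\<in>UNIV. Pair j ` UNIV)"
    proof (rule sum_has_sum)
      fix j
      have "((\<lambda>n. (cmod (L2_inner ?Q w (exp_family \<delta> (j, n))))\<^sup>2) has_sum
          (\<integral>x. (cmod ((?\<Gamma> *v V x) $ j))\<^sup>2 \<partial>?C)) UNIV"
        using Parseval_unit_cube[OF G[of j]] unfolding inner cmod_G .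
      then show "((\<lambda>k. (cmod (L2_inner ?Q w (exp_family \<delta> k)))\<^sup>2) has_sum
          (\<integral>x. (cmod ((?\<Gamma> *v V x) $ j))\<^sup>2 \<partial>?C)) (Pair j ` UNIV)"
        by (subst has_sum_reindex) (auto simp: inj_on_def o_def)
    qed auto
    moreover have "(\<Union>j\<in>UNIV. Pair j ` UNIV) = (UNIV :: ('n \<times> (int^'d)) set)"
      by auto
    ultimately have sum: "((\<lambda>k. (cmod (L2_inner ?Q w (exp_family \<delta> k)))\<^sup>2) has_sum ?S) UNIV"
      by simp
    have norm: "(L2_norm ?Q w)\<^sup>2 = (\<Sum>p\<in>UNIV. \<integral>x. (cmod (V x $ p))\<^sup>2 \<partial>?C)"
      unfolding L2_norm_power2 integral_cube_union[OF assms(1) L2_space_integrable[OF w]]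
      by (simp add: V_def W_def)
    show ?thesis
      using bounds[rule_format, of V, OF V] infsumI[OF sum] has_sum_imp_summable[OF sum] unfolding norm by simp
  qed
  then show ?thesis
    unfolding is_frame_def using ab exp_family_L2 by blast
qed

text \<open>A finite combination sums over the row index \<open>j\<close>, so its restrictions to
  the cubes are the entries of the transposed matrix applied to a field of twisted trigonometric
  polynomials.\<close>

lemma is_Riesz_sequence_exp_family:
  fixes M :: "'n::finite \<Rightarrow> int^'d"
  assumes "inj M" and det: "det (exp_matrix M \<delta>) \<noteq> 0"
  shows "is_Riesz_sequence (lebesgue_on (cube_union M)) (exp_family \<delta>)"
proof -
  let ?\<Gamma> = "exp_matrix M \<delta>" and ?Q = "lebesgue_on (cube_union M)" and ?C = "lebesgue_on (unit_cube :: (real^'d) set)"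
  have det': "det (transpose ?\<Gamma>) \<noteq> 0"
    using det by simp
  obtain A B where AB: "A > 0" "B > 0"
    and bounds: "\<forall>V. (\<forall>i. (\<lambda>x. V x $ i) \<in> L2_space ?C) \<longrightarrow>
      A * (\<Sum>i\<in>UNIV. \<integral>x. (cmod (V x $ i))\<^sup>2 \<partial>?C) \<le> (\<Sum>i\<in>UNIV. \<integral>x. (cmod ((transpose ?\<Gamma> *v V x) $ i))\<^sup>2 \<partial>?C) \<and>
      (\<Sum>i\<in>UNIV. \<integral>x. (cmod ((transpose ?\<Gamma> *v V x) $ i))\<^sup>2 \<partial>?C) \<le> B * (\<Sum>i\<in>UNIV. \<integral>x. (cmod (V x $ i))\<^sup>2 \<partial>?C)"
    using matrix_L2_bounds[OF det', of ?C] by (elim exE conjE)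
  have "A * (\<Sum>k\<in>J. (cmod (a k))\<^sup>2) \<le> (L2_norm ?Q (\<lambda>x. \<Sum>k\<in>J. a k * exp_family \<delta> k x))\<^sup>2 \<and>
      (L2_norm ?Q (\<lambda>x. \<Sum>k\<in>J. a k * exp_family \<delta> k x))\<^sup>2 \<le> B * (\<Sum>k\<in>J. (cmod (a k))\<^sup>2)"
    if J: "finite J" for J and a :: "'n \<times> (int^'d) \<Rightarrow> complex"
  proof -
    define K where "K j = {n. (j, n) \<in> J}" for j
    have fin: "finite (K j)" for j
      using finite_vimageI[OF J, of "Pair j"] by (simp add: K_def vimage_def inj_on_def)
    have sum_J: "sum f J = (\<Sum>j\<in>UNIV. \<Sum>n\<in>K j. f (j, n))" for f :: "'n \<times> (int^'d) \<Rightarrow> 'c::comm_monoid_add"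
    proof -
      have "J = (SIGMA j:UNIV. K j)"
        by (auto simp: K_def)
      then show ?thesis
        using fin by (simp add: sum.Sigma)
    qed
    \<comment> \<open>The part of the combination with shift \<open>j\<close>, seen on the unit
      cube. Its squared norm is the sum of its squared coefficients, by orthonormality and because
      the twist is unimodular.\<close>
    define H where "H x = (\<chi> j. (\<Sum>n\<in>K j. a (j, n) * cube_exp n x) * twist (\<delta> $ j) x)" for x
    have H: "(\<lambda>x. H x $ j) \<in> L2_space ?C" for j
      unfolding H_def by (simp add: L2_twist L2_space_sum L2_space_mult cube.L2)
    have "(\<Sum>k\<in>J. (cmod (a k))\<^sup>2) = (\<Sum>j\<in>UNIV. \<Sum>n\<in>K j. (cmod (a (j, n)))\<^sup>2)"
      by (rule sum_J)
    also have "\<dots> = (\<Sum>j\<in>UNIV. \<integral>x. (cmod (H x $ j))\<^sup>2 \<partial>?C)"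
      by (simp add: H_def norm_mult cube.norm_sum_power2[OF fin])
    finally have coeff: "(\<Sum>k\<in>J. (cmod (a k))\<^sup>2) = (\<Sum>j\<in>UNIV. \<integral>x. (cmod (H x $ j))\<^sup>2 \<partial>?C)" .
    have f: "(\<lambda>x. \<Sum>k\<in>J. a k * exp_family \<delta> k x) \<in> L2_space ?Q"
      by (intro L2_space_sum L2_space_mult exp_family_L2)
    have translate: "(\<Sum>k\<in>J. a k * exp_family \<delta> k (x + real_vec (M p))) = (transpose ?\<Gamma> *v H x) $ p" for x p
      unfolding sum_J exp_family_translate
      by (simp add: matrix_vector_mult_def transpose_def H_def sum_distrib_left sum_distrib_right mult_ac)
    have "(L2_norm ?Q (\<lambda>x. \<Sum>k\<in>J. a k * exp_family \<delta> k x))\<^sup>2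
        = (\<Sum>p\<in>UNIV. \<integral>x. (cmod ((transpose ?\<Gamma> *v H x) $ p))\<^sup>2 \<partial>?C)"
      unfolding L2_norm_power2 integral_cube_union[OF assms(1) L2_space_integrable[OF f]] translate ..
    then show ?thesis
      using bounds[rule_format, of H, OF H] unfolding coeff by simp
  qed
  then show ?thesis
    unfolding is_Riesz_sequence_def using AB exp_family_L2 by blast
qed

section \<open>The exceptional set of shifts\<close>

lemma null_set_det_exp_matrix:
  fixes M :: "'n::finite \<Rightarrow> int^'d"
  assumes "inj M"
  shows "{\<delta>. det (exp_matrix M \<delta>) = 0} \<in> null_sets lborel"
proof -
  let ?S = "{\<sigma>. \<sigma> permutes (UNIV :: 'n set)}"
  \<comment> \<open>The frequency of the permutation \<open>\<sigma>\<close> in the Leibniz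
    expansion of the determinant; injectivity of \<open>M\<close> makes different permutations have
    different frequencies.\<close>
  define w :: "('n \<Rightarrow> 'n) \<Rightarrow> real^'d^'n" where "w \<sigma> = (\<chi> j. (2 * pi) *\<^sub>R real_vec (M (\<sigma> j)))" for \<sigma>
  have "inj w"
  proof (rule injI, rule ext)
    fix \<sigma> \<tau> j assume "w \<sigma> = w \<tau>"
    then have "w \<sigma> $ j = w \<tau> $ j"
      by simp
    then show "\<sigma> j = \<tau> j"
      using assms by (simp add: w_def real_vec_eq_iff inj_eq)
  qed
  \<comment> \<open>The identity permutation, with sign 1, witnesses a nonzero coefficient.\<close>
  have "{\<delta>. (\<Sum>\<sigma>\<in>?S. of_int (sign \<sigma>) * exp (\<i> * of_real (w \<sigma> \<bullet> \<delta>))) = 0} \<in> null_sets lborel"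
    by (rule null_set_zeros_trig_sum[where k = id])
      (use \<open>inj w\<close> in \<open>auto intro: inj_on_subset simp: permutes_id sign_id\<close>)
  moreover have "det (exp_matrix M \<delta>) = (\<Sum>\<sigma>\<in>?S. of_int (sign \<sigma>) * exp (\<i> * of_real (w \<sigma> \<bullet> \<delta>)))" for \<delta>
  proof -
    have "(\<Prod>j\<in>UNIV. exp_matrix M \<delta> $ j $ \<sigma> j) = exp (\<i> * of_real (w \<sigma> \<bullet> \<delta>))" for \<sigma>
    proof -
      have "(\<Prod>j\<in>UNIV. exp_matrix M \<delta> $ j $ \<sigma> j)
          = exp (\<Sum>j\<in>UNIV. 2 * complex_of_real pi * \<i> * of_real (\<delta> $ j \<bullet> real_vec (M (\<sigma> j))))"
        by (simp add: exp_matrix_def exp_sum)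
      also have "(\<Sum>j\<in>UNIV. 2 * complex_of_real pi * \<i> * of_real (\<delta> $ j \<bullet> real_vec (M (\<sigma> j))))
          = \<i> * of_real (w \<sigma> \<bullet> \<delta>)"
        unfolding inner_vec_def[of "w \<sigma>" \<delta>] of_real_sum sum_distrib_left
        by (intro sum.cong refl) (simp add: w_def inner_commute)
      finally show ?thesis .
    qed
    then show ?thesis
      by (simp add: det_def)
  qed
  ultimately show ?thesis
    by simp
qed

theorem theorem1p3:
  fixes M :: "'n::finite \<Rightarrow> int ^ 'd::finite"
  assumes "inj M"
  shows "{\<delta> :: real ^ 'd ^ 'n. \<not> is_Riesz_basis (lebesgue_on (cube_union M)) (exp_family \<delta>)}
           \<in> null_sets lebesgue"
proof -
  have "negligible {\<delta>. det (exp_matrix M \<delta>) = 0}"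
    unfolding negligible_iff_null_sets
    by (rule null_sets_completionI[OF null_set_det_exp_matrix[OF assms]])
  \<comment> \<open>A nonzero determinant gives a Riesz basis, so the set lies inside the zero set
    of the determinant; completeness of Lebesgue measure then makes it measurable and null.\<close>
  then have "negligible {\<delta> :: real^'d^'n. \<not> is_Riesz_basis (lebesgue_on (cube_union M)) (exp_family \<delta>)}"
    by (rule negligible_subset)
      (auto simp: is_Riesz_basis_def dest: is_frame_exp_family[OF assms] is_Riesz_sequence_exp_family[OF assms])
  then show ?thesis
    by (simp add: negligible_iff_null_sets)
qed

end
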